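(* (Coherence for monoids.) Let $\mathcal{C}$ be a multicategory, left-skew multicategory, right-skew multicategory or bi-skew multicategory. Then there is an isomorphism of categories $\mathbf{UnbiasMon}(\mathcal{C})\cong\mathbf{Mon}(\mathcal{C})$ sending an unbiased monoid in $\mathcal{C}$ to its biased counterpart and a homomorphism to itself.
   Context: Lists $\vec a$ of objects may be empty unless stated otherwise. $x^{(n)}$ is the list consisting of $x$ repeated $n$ times. **Multicategory.** A class of objects; for each list $\vec a$ and object $x$ a set of morphisms $\vec a\to x$; identities $\mathrm{id}_x:x\to x$; for $f:\vec c\to x$ and $g:\vec b,x,\vec d\to y$ a composite $g\circ_x f:\vec b,\vec c,\vec d\to y$ (at the specified occurrence of $x$). Axioms: associativity $h\circ_y(g\circ_x f)=(h\circ_y g)\circ_x f$; interchange (composing two morphisms into two distinct inputs of $h$ gives the same result in either order); left and right identity laws. A map sends objects to objects and morphisms to morphisms, preserving identities and composition. A 2-cell $\alpha:F\Rightarrow G$ gives for each object $x$ a morphism $\alpha_x:Fx\to Gx$ such that for $f:a_0,\ldots,a_{n-1}\to b$, $\alpha_b\circ Ff=Gf\circ(\alpha_{a_0},\ldots,\alpha_{a_{n-1}})$. A monoid is an object $x$ with $m:x,x\to x$ and $e:\ \to x$ such that composing $e$ into either input of $m$ gives $\mathrm{id}_x$, and composing $m$ into the first input of $m$ equals composing $m$ into the second input. A homomorphism $(x,m,e)\to(y,n,u)$ is $f:x\to y$ with $f\circ e=u$ and $f\circ m=n\circ(f,f)$. **Left-skew multicategory.** A class of objects; for each list $\vec a$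 and object $x$ a set of loose morphisms $\vec a\to x$; for each nonempty $\vec a$ and $x$ a set of tight morphisms $\lfloor\vec a\to x$; loosening, sending each tight $f:\lfloor\vec a\to x$ to a loose $\acute f:\vec a\to x$; tight identities $\mathrm{id}_x:\lfloor x\to x$; compositions $g\circ_x f$ of forms: - (A) $f:\vec b\to x$, $g:\vec a,x,\vec c\to y$ loose, giving loose $\vec a,\vec b,\vec c\to y$; - (B) $f:\lfloor\vec a\to x$, $g:\lfloor x,\vec b\to y$ tight, giving tight $\lfloor\vec a,\vec b\to y$; - (C) $f:\vec b\to x$ loose, $g:\lfloor\vec a,x,\vec c\to y$ tight with $\vec a$ nonempty, giving tight $\lfloor\vec a,\vec b,\vec c\to y$. Axioms: loosening commutes with (B) and (C) (the loosening of a composite is the (A)-composite of the loosenings, loose arguments being unchanged); composing an identity (loosened as needed) into any input of $g$ gives $g$; composing any $f$ into an identity (loosened as needed) gives $f$; associativity and interchange for all well-typed combinations of forms. Maps preserve objects, both kinds of morphisms and all structure; a 2-cell $\alpha:F\Rightarrow G$ gives tight morphisms $\alpha_x:\lfloor Fx\to Gx$ such that for every loose $f:a_0,\ldots,a_{n-1}\to b$, $\acute\alpha_b\circ Ff=Gf\circ(\acute\alpha_{a_0},\ldots,\acute\alpha_{a_{n-1}})$, and for every tight $f:\lfloor a_0,\ldots,a_{n-1}\to b$, $\alpha_b\circ Ff=Gf\circ(\alpha_{a_0},\acute\alpha_{a_1},\ldots,\acute\alpha_{a_{n-1}})$. A monoid is an object $x$ with a tight $m:\lfloor x,x\to x$ and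 loose $e:\ \to x$ such that: composing $e$ into the first input of $\acute m$ gives $\acute{\mathrm{id}}_x$; composing $e$ into the second input of $m$ gives $\mathrm{id}_x$; composing $m$ into the first input of $m$ equals composing $\acute m$ into the second input of $m$. A homomorphism $(x,m,e)\to(y,n,u)$ is a tight $f:\lfloor x\to y$ with $\acute f\circ e=u$ and $f\circ m=n\circ(f,\acute f)$. **Right-skew multicategory.** The dual notion under reversal of lists: a right-skew multicategory $\mathcal{C}$ amounts to a left-skew multicategory $\mathcal{C}^{\mathrm{rev}}$ whose morphisms from $a_0,\ldots,a_{n-1}$ are the morphisms of $\mathcal{C}$ from $a_{n-1},\ldots,a_0$ (so tight morphisms $\vec a\rfloor\to x$ distinguish the last input). Maps, 2-cells, monoids, homomorphisms, unbiased monoids and biased counterparts for $\mathcal{C}$ are those for $\mathcal{C}^{\mathrm{rev}}$. **Bi-skew multicategory.** A class of objects; for every list $\vec a$ and object $x$ a set of loose-loose morphisms $\vec a\to x$; for every nonempty $\vec a$ and $x$ sets of tight-loose morphisms $\lfloor\vec a\to x$, loose-tight morphisms $\vec a\rfloor\to x$, and tight-tight morphisms $\lfloor\vec a\rfloor\to x$; left-loosening $f\mapsto\acute f$ (tight-loose to loose-loose, tight-tight to loose-tight); right-loosening $f\mapsto\grave f$ (loose-tight to loose-loose, tight-tight to tight-loose); tight-tight identities $\mathrm{id}_x:\lfloor x\rfloor\to x$; compositions $g\circ_x f$ of forms: - (A) $g:\vec a,x,\vec c\to y$, $f:\vec b\to x$, giving $\vec a,\vec b,\vec c\to y$; - (B)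 $g:\lfloor\vec a,x,\vec c\to y$ with $\vec a$ nonempty, $f:\vec b\to x$, giving $\lfloor\vec a,\vec b,\vec c\to y$; - (C) $g:\vec a,x,\vec c\rfloor\to y$ with $\vec c$ nonempty, $f:\vec b\to x$, giving $\vec a,\vec b,\vec c\rfloor\to y$; - (D) $g:\lfloor\vec a,x,\vec c\rfloor\to y$ with $\vec a,\vec c$ nonempty, $f:\vec b\to x$, giving $\lfloor\vec a,\vec b,\vec c\rfloor\to y$; - (E) $g:\lfloor x,\vec b\to y$, $f:\lfloor\vec a\to x$, giving $\lfloor\vec a,\vec b\to y$; - (F) $g:\lfloor x,\vec b\rfloor\to y$ with $\vec b$ nonempty, $f:\lfloor\vec a\to x$, giving $\lfloor\vec a,\vec b\rfloor\to y$; - (G) $g:\vec a,x\rfloor\to y$, $f:\vec b\rfloor\to x$, giving $\vec a,\vec b\rfloor\to y$; - (H) $g:\lfloor\vec a,x\rfloor\to y$ with $\vec a$ nonempty, $f:\vec b\rfloor\to x$, giving $\lfloor\vec a,\vec b\rfloor\to y$; - (I) $g:\lfloor x\rfloor\to y$, $f:\lfloor\vec a\rfloor\to x$, giving $\lfloor\vec a\rfloor\to y$. Axioms: left- and right-loosening commute (write $\hat f$ for both applied to a tight-tight $f$); left-loosening commutes with each form whose $g$ is left-tight, right-loosening with each form whose $g$ is right-tight (the loosening of the composite is the composite of the loosened $g$ with $f$, where $f$ is loosened on the same side if it is tight on that side); composing an identity (loosened as needed) into any input of $g$ gives $g$; composing any $f$ into an identity (loosened as needed) gives $f$; associativity and interchange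 for all well-typed combinations of forms. Maps preserve objects, all four kinds of morphisms and all structure. A 2-cell $\alpha:F\Rightarrow G$ gives tight-tight $\alpha_x:\lfloor Fx\rfloor\to Gx$, natural with respect to morphisms of each of the four kinds: $\alpha_b$ after $Ff$ equals $Gf$ after the $\alpha_{a_i}$, each $\alpha$ being loosened as its position requires. A monoid is an object $x$ with tight-tight $m:\lfloor x,x\rfloor\to x$ and loose-loose $e:\ \to x$ such that: composing $e$ into the first input of $\acute m$ gives $\acute{\mathrm{id}}_x$; composing $e$ into the second input of $\grave m$ gives $\grave{\mathrm{id}}_x$; composing $\grave m$ into the first input of $m$ equals composing $\acute m$ into the second input of $m$. A homomorphism $(x,m,e)\to(y,n,u)$ is a tight-tight $f:\lfloor x\rfloor\to y$ with $\hat f\circ e=u$ and $f\circ m=n\circ(\grave f,\acute f)$. In each case $\mathbf{Mon}(\mathcal{C})$ is the category of monoids and homomorphisms. **Unbiased monoids.** In each case, let $1$ be the terminal object of the respective 2-category (one object, and exactly one morphism in each hom-set of each kind). $\mathbf{UnbiasMon}(\mathcal{C})$ is the hom-category from $1$ to $\mathcal{C}$: its objects (unbiased monoids) are maps $1\to\mathcal{C}$ and its morphisms (homomorphisms) are 2-cells. Explicitly an unbiased monoid is an object $x$ together with: - for a multicategory, $m_n:x^{(n)}\to x$ for each $n\ge0$; - for a left-skew multicategory, loose $m^{\mathsf L}_n:x^{(n)}\to x$ for $n\ge0$ and tight $m^{\mathsf T}_n:\lfloor x^{(n)}\to x$ for $n>0$; - for a bi-skew multicategory, loose-loose $m^{\mathsf{LL}}_n:x^{(n)}\to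 x$ for $n\ge0$, and for $n>0$ tight-loose $m^{\mathsf{TL}}_n$, loose-tight $m^{\mathsf{LT}}_n$ and tight-tight $m^{\mathsf{TT}}_n$ from $x^{(n)}$ to $x$; compatible with loosening, identities and every kind of composition. Homomorphisms are morphisms $x\to y$ (resp. tight, tight-tight) compatible with each kind of multiplication. The **biased counterpart** of an unbiased monoid is the monoid $(x,m_2,m_0)$, resp. $(x,m^{\mathsf T}_2,m^{\mathsf L}_0)$, resp. $(x,m^{\mathsf{TT}}_2,m^{\mathsf{LL}}_0)$. *)

theory Defs
  imports Main "HOL-Library.FuncSet"
begin

section \<open>Categories\<close>

text \<open>Hom-sets are indexed by source and target and are not required to be disjoint; accordingly
  composition and the arrow part of a functor take the objects involved as arguments.\<close>

record ('a, 'f) cat =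
  Ob :: "'a set"
  Arr :: "'a \<Rightarrow> 'a \<Rightarrow> 'f set"
  Ident :: "'a \<Rightarrow> 'f"
  Compose :: "'a \<Rightarrow> 'a \<Rightarrow> 'a \<Rightarrow> 'f \<Rightarrow> 'f \<Rightarrow> 'f"

definition category :: "('a, 'f) cat \<Rightarrow> bool" where
  "category A \<longleftrightarrow>
     (\<forall>a\<in>Ob A. Ident A a \<in> Arr A a a) \<and>
     (\<forall>a\<in>Ob A. \<forall>b\<in>Ob A. \<forall>c\<in>Ob A. \<forall>f\<in>Arr A a b. \<forall>g\<in>Arr A b c.
        Compose A a b c g f \<in> Arr A a c) \<and>
     (\<forall>a\<in>Ob A. \<forall>b\<in>Ob A. \<forall>f\<in>Arr A a b.
        Compose A a a b f (Ident A a) = f \<and> Compose A a b b (Ident A b) f = f) \<and>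
     (\<forall>a\<in>Ob A. \<forall>b\<in>Ob A. \<forall>c\<in>Ob A. \<forall>d\<in>Ob A.
        \<forall>f\<in>Arr A a b. \<forall>g\<in>Arr A b c. \<forall>h\<in>Arr A c d.
        Compose A a b d (Compose A b c d h g) f = Compose A a c d h (Compose A a b c g f))"

definition is_functor ::
  "('a, 'f) cat \<Rightarrow> ('b, 'g) cat \<Rightarrow> ('a \<Rightarrow> 'b) \<Rightarrow> ('a \<Rightarrow> 'a \<Rightarrow> 'f \<Rightarrow> 'g) \<Rightarrow> bool" where
  "is_functor A B Fo Fa \<longleftrightarrow> category A \<and> category B \<and>
     (\<forall>a\<in>Ob A. Fo a \<in> Ob B) \<and>
     (\<forall>a\<in>Ob A. \<forall>b\<in>Ob A. \<forall>f\<in>Arr A a b. Fa a b f \<in> Arr B (Fo a) (Fo b)) \<and>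
     (\<forall>a\<in>Ob A. Fa a a (Ident A a) = Ident B (Fo a)) \<and>
     (\<forall>a\<in>Ob A. \<forall>b\<in>Ob A. \<forall>c\<in>Ob A. \<forall>f\<in>Arr A a b. \<forall>g\<in>Arr A b c.
        Fa a c (Compose A a b c g f) = Compose B (Fo a) (Fo b) (Fo c) (Fa b c g) (Fa a b f))"

definition isomorphism_of_categories ::
  "('a, 'f) cat \<Rightarrow> ('b, 'g) cat \<Rightarrow> ('a \<Rightarrow> 'b) \<Rightarrow> ('a \<Rightarrow> 'a \<Rightarrow> 'f \<Rightarrow> 'g) \<Rightarrow> bool" where
  "isomorphism_of_categories A B Fo Fa \<longleftrightarrow> is_functor A B Fo Fa \<and>
     (\<exists>Go Ga. is_functor B A Go Ga \<and>
        (\<forall>a\<in>Ob A. Go (Fo a) = a) \<and>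
        (\<forall>b\<in>Ob B. Fo (Go b) = b) \<and>
        (\<forall>a\<in>Ob A. \<forall>a'\<in>Ob A. \<forall>f\<in>Arr A a a'. Ga (Fo a) (Fo a') (Fa a a' f) = f) \<and>
        (\<forall>b\<in>Ob B. \<forall>b'\<in>Ob B. \<forall>g\<in>Arr B b b'. Fa (Go b) (Go b') (Ga b b' g) = g))"


section \<open>Multicategories\<close>

text \<open>As for categories, the hom-sets form a family indexed by the source list and the target.
  For \<open>g\<close> from \<open>as @ x # cs\<close> to \<open>y\<close> and \<open>f\<close> from \<open>bs\<close> to \<open>x\<close>, the composite of \<open>g\<close> with \<open>f\<close> at the
  displayed occurrence of \<open>x\<close> is \<open>MComp C as bs cs x y g f\<close>; its source is \<open>as @ bs @ cs\<close>.\<close>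

record ('o, 'm) multicat =
  MObj :: "'o set"
  MHom :: "'o list \<Rightarrow> 'o \<Rightarrow> 'm set"
  MId :: "'o \<Rightarrow> 'm"
  MComp :: "'o list \<Rightarrow> 'o list \<Rightarrow> 'o list \<Rightarrow> 'o \<Rightarrow> 'o \<Rightarrow> 'm \<Rightarrow> 'm \<Rightarrow> 'm"

text \<open>Hom-sets indexed by anything other than objects are not part of the data;
  \<open>hom_obj\<close> makes them empty, so that \<open>f \<in> MHom C as x\<close> entails that \<open>as\<close> and \<open>x\<close> consist
  of objects.\<close>

locale multicategory =
  fixes C :: "('o, 'm) multicat"
  assumes hom_obj: "f \<in> MHom C as x \<Longrightarrow> set as \<subseteq> MObj C \<and> x \<in> MObj C"
    and id_hom: "x \<in> MObj C \<Longrightarrow> MId C x \<in> MHom C [x] x"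
    and comp_hom: "\<lbrakk>g \<in> MHom C (as @ x # cs) y; f \<in> MHom C bs x\<rbrakk>
          \<Longrightarrow> MComp C as bs cs x y g f \<in> MHom C (as @ bs @ cs) y"
    and assoc: "\<lbrakk>h \<in> MHom C (ds @ y # es) z; g \<in> MHom C (as @ x # cs) y; f \<in> MHom C bs x\<rbrakk>
          \<Longrightarrow> MComp C ds (as @ bs @ cs) es y z h (MComp C as bs cs x y g f)
            = MComp C (ds @ as) bs (cs @ es) x z (MComp C ds (as @ x # cs) es y z h g) f"
    and interchange: "\<lbrakk>h \<in> MHom C (as @ x # bs @ y # cs) z; f \<in> MHom C ds x; g \<in> MHom C es y\<rbrakk>
          \<Longrightarrow> MComp C (as @ ds @ bs) es cs y z (MComp C as ds (bs @ y # cs) x z h f) g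
            = MComp C as ds (bs @ es @ cs) x z (MComp C (as @ x # bs) es cs y z h g) f"
    and comp_id: "g \<in> MHom C (as @ x # cs) y
          \<Longrightarrow> MComp C as [x] cs x y g (MId C x) = g"
    and id_comp: "f \<in> MHom C bs x \<Longrightarrow> MComp C [] bs [] x x (MId C x) f = f"

text \<open>Maps and 2-cells are kept extensional (undefined outside their domain), so that equality
  of functions is equality of maps and of 2-cells.\<close>

record ('o, 'm, 'p, 'n) multicat_map =
  mobj :: "'o \<Rightarrow> 'p"
  mhom :: "'o list \<Rightarrow> 'o \<Rightarrow> 'm \<Rightarrow> 'n"

definition is_multicat_map ::
  "('o, 'm) multicat \<Rightarrow> ('p, 'n) multicat \<Rightarrow> ('o, 'm, 'p, 'n) multicat_map \<Rightarrow> bool" where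
  "is_multicat_map C D F \<longleftrightarrow>
     mobj F \<in> MObj C \<rightarrow>\<^sub>E MObj D \<and>
     (\<forall>as x. mhom F as x \<in> MHom C as x \<rightarrow>\<^sub>E MHom D (map (mobj F) as) (mobj F x)) \<and>
     (\<forall>x\<in>MObj C. mhom F [x] x (MId C x) = MId D (mobj F x)) \<and>
     (\<forall>as bs cs x y. \<forall>g\<in>MHom C (as @ x # cs) y. \<forall>f\<in>MHom C bs x.
        mhom F (as @ bs @ cs) y (MComp C as bs cs x y g f)
        = MComp D (map (mobj F) as) (map (mobj F) bs) (map (mobj F) cs) (mobj F x) (mobj F y)
            (mhom F (as @ x # cs) y g) (mhom F bs x f))"

text \<open>\<open>MComps C [] [(a\<^sub>0, b\<^sub>0, f\<^sub>0), \<dots>] y g\<close> is the simultaneous composite of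
  \<open>g\<close> from \<open>[b\<^sub>0, \<dots>]\<close> to \<open>y\<close> with unary morphisms \<open>f\<^sub>i\<close> from \<open>a\<^sub>i\<close> to \<open>b\<^sub>i\<close>,
  computed from left to right; the argument \<open>pre\<close> lists the sources of the morphisms already
  plugged in.\<close>

primrec MComps ::
  "('o, 'm) multicat \<Rightarrow> 'o list \<Rightarrow> ('o \<times> 'o \<times> 'm) list \<Rightarrow> 'o \<Rightarrow> 'm \<Rightarrow> 'm" where
  "MComps C pre [] y g = g"
| "MComps C pre (t # ts) y g = (case t of (a, b, f) \<Rightarrow>
     MComps C (pre @ [a]) ts y (MComp C pre [a] (map (fst \<circ> snd) ts) b y g f))"

definition is_multicat_cell ::
  "('o, 'm) multicat \<Rightarrow> ('p, 'n) multicat \<Rightarrow> ('o, 'm, 'p, 'n) multicat_map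
     \<Rightarrow> ('o, 'm, 'p, 'n) multicat_map \<Rightarrow> ('o \<Rightarrow> 'n) \<Rightarrow> bool" where
  "is_multicat_cell C D F G \<alpha> \<longleftrightarrow>
     \<alpha> \<in> extensional (MObj C) \<and>
     (\<forall>x\<in>MObj C. \<alpha> x \<in> MHom D [mobj F x] (mobj G x)) \<and>
     (\<forall>as b. \<forall>f\<in>MHom C as b.
        MComp D [] (map (mobj F) as) [] (mobj F b) (mobj G b) (\<alpha> b) (mhom F as b f)
        = MComps D [] (map (\<lambda>a. (mobj F a, mobj G a, \<alpha> a)) as) (mobj G b) (mhom G as b f))"

definition multicat_hom_category ::
  "('o, 'm) multicat \<Rightarrow> ('p, 'n) multicat
     \<Rightarrow> (('o, 'm, 'p, 'n) multicat_map, 'o \<Rightarrow> 'n) cat" where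
  "multicat_hom_category C D = \<lparr>
     Ob = {F. is_multicat_map C D F},
     Arr = (\<lambda>F G. {\<alpha>. is_multicat_cell C D F G \<alpha>}),
     Ident = (\<lambda>F. \<lambda>x\<in>MObj C. MId D (mobj F x)),
     Compose = (\<lambda>F G H \<beta> \<alpha>. \<lambda>x\<in>MObj C.
       MComp D [] [mobj F x] [] (mobj G x) (mobj H x) (\<beta> x) (\<alpha> x)) \<rparr>"

definition terminal_multicat :: "(unit, unit) multicat" where
  "terminal_multicat = \<lparr>
     MObj = UNIV,
     MHom = (\<lambda>as x. UNIV),
     MId = (\<lambda>x. ()),
     MComp = (\<lambda>as bs cs x y g f. ()) \<rparr>"

lemma multicategory_terminal: "multicategory terminal_multicat"
  by unfold_locales (auto simp: terminal_multicat_def)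

definition is_monoid :: "('o, 'm) multicat \<Rightarrow> 'o \<times> 'm \<times> 'm \<Rightarrow> bool" where
  "is_monoid C = (\<lambda>(x, m, e).
     x \<in> MObj C \<and> m \<in> MHom C [x, x] x \<and> e \<in> MHom C [] x \<and>
     MComp C [] [] [x] x x m e = MId C x \<and>
     MComp C [x] [] [] x x m e = MId C x \<and>
     MComp C [] [x, x] [x] x x m m = MComp C [x] [x, x] [] x x m m)"

definition is_monoid_hom ::
  "('o, 'm) multicat \<Rightarrow> 'o \<times> 'm \<times> 'm \<Rightarrow> 'o \<times> 'm \<times> 'm \<Rightarrow> 'm \<Rightarrow> bool" where
  "is_monoid_hom C = (\<lambda>(x, m, e) (y, n, u) f.
     f \<in> MHom C [x] y \<and>
     MComp C [] [] [] x y f e = u \<and>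
     MComp C [] [x, x] [] x y f m = MComps C [] [(x, y, f), (x, y, f)] y n)"

definition Mon :: "('o, 'm) multicat \<Rightarrow> ('o \<times> 'm \<times> 'm, 'm) cat" where
  "Mon C = \<lparr>
     Ob = {M. is_monoid C M},
     Arr = (\<lambda>M N. {f. is_monoid_hom C M N f}),
     Ident = (\<lambda>(x, m, e). MId C x),
     Compose = (\<lambda>(x, _) (y, _) (z, _) g f. MComp C [] [x] [] y z g f) \<rparr>"

definition UnbiasMon ::
  "('o, 'm) multicat \<Rightarrow> ((unit, unit, 'o, 'm) multicat_map, unit \<Rightarrow> 'm) cat" where
  "UnbiasMon C = multicat_hom_category terminal_multicat C"

definition biased_counterpart :: "(unit, unit, 'o, 'm) multicat_map \<Rightarrow> 'o \<times> 'm \<times> 'm" where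
  "biased_counterpart F = (mobj F (), mhom F [(), ()] () (), mhom F [] () ())"


section \<open>Left- and right-skew multicategories\<close>

datatype tightness = Loose | Tight

text \<open>If \<open>g\<close> has tightness \<open>p\<close> on the left, then a morphism plugged into the input of \<open>g\<close> that is
  preceded by the inputs \<open>as\<close> must have tightness \<open>at_input p as\<close> on the left: tight precisely if
  \<open>g\<close> is tight and the input is the first one. On the right, \<open>as\<close> is the list of
  inputs that follow.\<close>

definition at_input :: "tightness \<Rightarrow> 'o list \<Rightarrow> tightness" where
  "at_input p as = (if as = [] then p else Loose)"

text \<open>For a left-skew multicategory, \<open>SHom C Loose as x\<close> and \<open>SHom C Tight as x\<close> are the sets of
  loose and of tight morphisms. The composite \<open>SComp C p as bs cs x y g f\<close>, of source
  \<open>as @ bs @ cs\<close>, is that of \<open>g \<in> SHom C p (as @ x # cs) y\<close> with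
  \<open>f \<in> SHom C (at_input p as) bs x\<close>, and has tightness \<open>p\<close>. There are thus three forms of
  composition: \<open>g\<close> loose, with \<open>f\<close> loose; \<open>g\<close> tight and \<open>as = []\<close>, with \<open>f\<close> tight; and \<open>g\<close> tight
  and \<open>as \<noteq> []\<close>, with \<open>f\<close> loose.
  The same record also carries right-skew multicategories, where \<open>f \<in> SHom C (at_input p cs) bs x\<close>
  instead.\<close>

record ('o, 'm) skew_multicat =
  SObj :: "'o set"
  SHom :: "tightness \<Rightarrow> 'o list \<Rightarrow> 'o \<Rightarrow> 'm set"
  SLoosen :: "'o list \<Rightarrow> 'o \<Rightarrow> 'm \<Rightarrow> 'm"
  SId :: "'o \<Rightarrow> 'm"
  SComp :: "tightness \<Rightarrow> 'o list \<Rightarrow> 'o list \<Rightarrow> 'o list \<Rightarrow> 'o \<Rightarrow> 'o \<Rightarrow> 'm \<Rightarrow> 'm \<Rightarrow> 'm"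

text \<open>A tight morphism, loosened if loose is required:\<close>

definition SLoosen_to ::
  "('o, 'm) skew_multicat \<Rightarrow> tightness \<Rightarrow> 'o list \<Rightarrow> 'o \<Rightarrow> 'm \<Rightarrow> 'm" where
  "SLoosen_to C p as x f = (case p of Loose \<Rightarrow> SLoosen C as x f | Tight \<Rightarrow> f)"

text \<open>Leaving \<open>p\<close> and the lists arbitrary, \<open>assoc\<close> and \<open>interchange\<close> range over all well-typed
  combinations of the forms of composition.\<close>

locale left_skew_multicategory =
  fixes C :: "('o, 'm) skew_multicat"
  assumes hom_obj: "f \<in> SHom C p as x \<Longrightarrow> set as \<subseteq> SObj C \<and> x \<in> SObj C"
    and tight_nonempty: "f \<in> SHom C Tight as x \<Longrightarrow> as \<noteq> []"
    and loosen_hom: "f \<in> SHom C Tight as x \<Longrightarrow> SLoosen C as x f \<in> SHom C Loose as x"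
    and id_hom: "x \<in> SObj C \<Longrightarrow> SId C x \<in> SHom C Tight [x] x"
    and comp_hom: "\<lbrakk>g \<in> SHom C p (as @ x # cs) y; f \<in> SHom C (at_input p as) bs x\<rbrakk>
          \<Longrightarrow> SComp C p as bs cs x y g f \<in> SHom C p (as @ bs @ cs) y"
    and loosen_comp:
          "\<lbrakk>g \<in> SHom C Tight (as @ x # cs) y; f \<in> SHom C (at_input Tight as) bs x\<rbrakk>
          \<Longrightarrow> SLoosen C (as @ bs @ cs) y (SComp C Tight as bs cs x y g f)
            = SComp C Loose as bs cs x y (SLoosen C (as @ x # cs) y g)
                (if as = [] then SLoosen C bs x f else f)"
    and assoc: "\<lbrakk>h \<in> SHom C p (ds @ y # es) z; g \<in> SHom C (at_input p ds) (as @ x # cs) y;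
            f \<in> SHom C (at_input (at_input p ds) as) bs x\<rbrakk>
          \<Longrightarrow> SComp C p ds (as @ bs @ cs) es y z h (SComp C (at_input p ds) as bs cs x y g f)
            = SComp C p (ds @ as) bs (cs @ es) x z (SComp C p ds (as @ x # cs) es y z h g) f"
    and interchange: "\<lbrakk>h \<in> SHom C p (as @ x # bs @ y # cs) z; f \<in> SHom C (at_input p as) ds x;
            g \<in> SHom C (at_input p (as @ x # bs)) es y\<rbrakk>
          \<Longrightarrow> SComp C p (as @ ds @ bs) es cs y z (SComp C p as ds (bs @ y # cs) x z h f) g
            = SComp C p as ds (bs @ es @ cs) x z (SComp C p (as @ x # bs) es cs y z h g) f"
    and comp_id: "g \<in> SHom C p (as @ x # cs) y
          \<Longrightarrow> SComp C p as [x] cs x y g (SLoosen_to C (at_input p as) [x] x (SId C x)) = g"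
    and id_comp: "f \<in> SHom C p bs x
          \<Longrightarrow> SComp C p [] bs [] x x (SLoosen_to C p [x] x (SId C x)) f = f"

record ('o, 'm, 'p, 'n) skew_map =
  sobj :: "'o \<Rightarrow> 'p"
  shom :: "tightness \<Rightarrow> 'o list \<Rightarrow> 'o \<Rightarrow> 'm \<Rightarrow> 'n"

definition is_left_skew_map ::
  "('o, 'm) skew_multicat \<Rightarrow> ('p, 'n) skew_multicat \<Rightarrow> ('o, 'm, 'p, 'n) skew_map \<Rightarrow> bool" where
  "is_left_skew_map C D F \<longleftrightarrow>
     sobj F \<in> SObj C \<rightarrow>\<^sub>E SObj D \<and>
     (\<forall>p as x. shom F p as x \<in> SHom C p as x \<rightarrow>\<^sub>E SHom D p (map (sobj F) as) (sobj F x)) \<and>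
     (\<forall>as x. \<forall>f\<in>SHom C Tight as x.
        shom F Loose as x (SLoosen C as x f)
        = SLoosen D (map (sobj F) as) (sobj F x) (shom F Tight as x f)) \<and>
     (\<forall>x\<in>SObj C. shom F Tight [x] x (SId C x) = SId D (sobj F x)) \<and>
     (\<forall>p as bs cs x y. \<forall>g\<in>SHom C p (as @ x # cs) y. \<forall>f\<in>SHom C (at_input p as) bs x.
        shom F p (as @ bs @ cs) y (SComp C p as bs cs x y g f)
        = SComp D p (map (sobj F) as) (map (sobj F) bs) (map (sobj F) cs) (sobj F x) (sobj F y)
            (shom F p (as @ x # cs) y g) (shom F (at_input p as) bs x f))"

text \<open>Simultaneous composition of \<open>g\<close>, of tightness \<open>p\<close>, with a list of tight unary morphisms,
  each loosened as its position requires.\<close>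

primrec SComps ::
  "('o, 'm) skew_multicat \<Rightarrow> tightness \<Rightarrow> 'o list \<Rightarrow> ('o \<times> 'o \<times> 'm) list \<Rightarrow> 'o \<Rightarrow> 'm \<Rightarrow> 'm" where
  "SComps C p pre [] y g = g"
| "SComps C p pre (t # ts) y g = (case t of (a, b, f) \<Rightarrow>
     SComps C p (pre @ [a]) ts y
       (SComp C p pre [a] (map (fst \<circ> snd) ts) b y g
          (SLoosen_to C (at_input p pre) [a] b f)))"

definition is_left_skew_cell ::
  "('o, 'm) skew_multicat \<Rightarrow> ('p, 'n) skew_multicat \<Rightarrow> ('o, 'm, 'p, 'n) skew_map
     \<Rightarrow> ('o, 'm, 'p, 'n) skew_map \<Rightarrow> ('o \<Rightarrow> 'n) \<Rightarrow> bool" where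
  "is_left_skew_cell C D F G \<alpha> \<longleftrightarrow>
     \<alpha> \<in> extensional (SObj C) \<and>
     (\<forall>x\<in>SObj C. \<alpha> x \<in> SHom D Tight [sobj F x] (sobj G x)) \<and>
     (\<forall>p as b. \<forall>f\<in>SHom C p as b.
        SComp D p [] (map (sobj F) as) [] (sobj F b) (sobj G b)
          (SLoosen_to D p [sobj F b] (sobj G b) (\<alpha> b)) (shom F p as b f)
        = SComps D p [] (map (\<lambda>a. (sobj F a, sobj G a, \<alpha> a)) as) (sobj G b) (shom G p as b f))"

definition left_skew_hom_category ::
  "('o, 'm) skew_multicat \<Rightarrow> ('p, 'n) skew_multicat
     \<Rightarrow> (('o, 'm, 'p, 'n) skew_map, 'o \<Rightarrow> 'n) cat" where
  "left_skew_hom_category C D = \<lparr>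
     Ob = {F. is_left_skew_map C D F},
     Arr = (\<lambda>F G. {\<alpha>. is_left_skew_cell C D F G \<alpha>}),
     Ident = (\<lambda>F. \<lambda>x\<in>SObj C. SId D (sobj F x)),
     Compose = (\<lambda>F G H \<beta> \<alpha>. \<lambda>x\<in>SObj C.
       SComp D Tight [] [sobj F x] [] (sobj G x) (sobj H x) (\<beta> x) (\<alpha> x)) \<rparr>"

definition terminal_left_skew :: "(unit, unit) skew_multicat" where
  "terminal_left_skew = \<lparr>
     SObj = UNIV,
     SHom = (\<lambda>p as x. if p = Tight \<and> as = [] then {} else UNIV),
     SLoosen = (\<lambda>as x f. ()),
     SId = (\<lambda>x. ()),
     SComp = (\<lambda>p as bs cs x y g f. ()) \<rparr>"

lemma left_skew_multicategory_terminal: "left_skew_multicategory terminal_left_skew"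
  by unfold_locales (auto simp: terminal_left_skew_def at_input_def split: if_splits)

definition is_left_skew_monoid :: "('o, 'm) skew_multicat \<Rightarrow> 'o \<times> 'm \<times> 'm \<Rightarrow> bool" where
  "is_left_skew_monoid C = (\<lambda>(x, m, e).
     x \<in> SObj C \<and> m \<in> SHom C Tight [x, x] x \<and> e \<in> SHom C Loose [] x \<and>
     SComp C Loose [] [] [x] x x (SLoosen C [x, x] x m) e = SLoosen C [x] x (SId C x) \<and>
     SComp C Tight [x] [] [] x x m e = SId C x \<and>
     SComp C Tight [] [x, x] [x] x x m m
     = SComp C Tight [x] [x, x] [] x x m (SLoosen C [x, x] x m))"

definition is_left_skew_monoid_hom ::
  "('o, 'm) skew_multicat \<Rightarrow> 'o \<times> 'm \<times> 'm \<Rightarrow> 'o \<times> 'm \<times> 'm \<Rightarrow> 'm \<Rightarrow> bool" where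
  "is_left_skew_monoid_hom C = (\<lambda>(x, m, e) (y, n, u) f.
     f \<in> SHom C Tight [x] y \<and>
     SComp C Loose [] [] [] x y (SLoosen C [x] y f) e = u \<and>
     SComp C Tight [] [x, x] [] x y f m = SComps C Tight [] [(x, y, f), (x, y, f)] y n)"

definition left_skew_Mon :: "('o, 'm) skew_multicat \<Rightarrow> ('o \<times> 'm \<times> 'm, 'm) cat" where
  "left_skew_Mon C = \<lparr>
     Ob = {M. is_left_skew_monoid C M},
     Arr = (\<lambda>M N. {f. is_left_skew_monoid_hom C M N f}),
     Ident = (\<lambda>(x, m, e). SId C x),
     Compose = (\<lambda>(x, _) (y, _) (z, _) g f. SComp C Tight [] [x] [] y z g f) \<rparr>"

definition left_skew_UnbiasMon ::
  "('o, 'm) skew_multicat \<Rightarrow> ((unit, unit, 'o, 'm) skew_map, unit \<Rightarrow> 'm) cat" where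
  "left_skew_UnbiasMon C = left_skew_hom_category terminal_left_skew C"

definition skew_biased_counterpart :: "(unit, unit, 'o, 'm) skew_map \<Rightarrow> 'o \<times> 'm \<times> 'm" where
  "skew_biased_counterpart F = (sobj F (), shom F Tight [(), ()] () (), shom F Loose [] () ())"

text \<open>Right-skew multicategories and their monoids are given by reversal of lists. Reversal leaves
  a pair of equal inputs unchanged, so the biased counterpart of an unbiased monoid needs no
  separate definition.\<close>

definition skew_rev :: "('o, 'm) skew_multicat \<Rightarrow> ('o, 'm) skew_multicat" where
  "skew_rev C = \<lparr>
     SObj = SObj C,
     SHom = (\<lambda>p as x. SHom C p (rev as) x),
     SLoosen = (\<lambda>as x f. SLoosen C (rev as) x f),
     SId = SId C,
     SComp = (\<lambda>p as bs cs x y g f. SComp C p (rev cs) (rev bs) (rev as) x y g f) \<rparr>"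

definition right_skew_multicategory :: "('o, 'm) skew_multicat \<Rightarrow> bool" where
  "right_skew_multicategory C \<longleftrightarrow> left_skew_multicategory (skew_rev C)"

lemma right_skew_comp_hom:
  assumes "right_skew_multicategory C"
    and "g \<in> SHom C p (as @ x # cs) y" "f \<in> SHom C (at_input p cs) bs x"
  shows "SComp C p as bs cs x y g f \<in> SHom C p (as @ bs @ cs) y"
  using left_skew_multicategory.comp_hom[of "skew_rev C" g p "rev cs" x "rev as" y f "rev bs"]
    assms by (simp add: right_skew_multicategory_def skew_rev_def at_input_def split: if_splits)

definition right_skew_Mon :: "('o, 'm) skew_multicat \<Rightarrow> ('o \<times> 'm \<times> 'm, 'm) cat" where
  "right_skew_Mon C = left_skew_Mon (skew_rev C)"

definition right_skew_UnbiasMon ::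
  "('o, 'm) skew_multicat \<Rightarrow> ((unit, unit, 'o, 'm) skew_map, unit \<Rightarrow> 'm) cat" where
  "right_skew_UnbiasMon C = left_skew_UnbiasMon (skew_rev C)"


section \<open>Bi-skew multicategories\<close>

text \<open>In \<open>BHom C p q as x\<close>, \<open>p\<close> is the tightness on the left and \<open>q\<close> that on the right.
  The composite \<open>BComp C p q as bs cs x y g f\<close>, of source \<open>as @ bs @ cs\<close>, is that of
  \<open>g \<in> BHom C p q (as @ x # cs) y\<close> with \<open>f \<in> BHom C (at_input p as) (at_input q cs) bs x\<close>, and lies
  in \<open>BHom C p q (as @ bs @ cs) y\<close>. There are nine forms of
  composition: one for \<open>p = q = Loose\<close>, where \<open>f\<close> is loose-loose; two if only \<open>p\<close> is tight, according
  to whether \<open>as = []\<close>; two if only \<open>q\<close> is tight, according to whether \<open>cs = []\<close>; and four if both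
  are tight.
  Left-loosening \<open>BLoosenL C q as x\<close> goes from \<open>BHom C Tight q as x\<close> to \<open>BHom C Loose q as x\<close>, and
  right-loosening \<open>BLoosenR C p as x\<close> from \<open>BHom C p Tight as x\<close> to \<open>BHom C p Loose as x\<close>.\<close>

record ('o, 'm) biskew_multicat =
  BObj :: "'o set"
  BHom :: "tightness \<Rightarrow> tightness \<Rightarrow> 'o list \<Rightarrow> 'o \<Rightarrow> 'm set"
  BLoosenL :: "tightness \<Rightarrow> 'o list \<Rightarrow> 'o \<Rightarrow> 'm \<Rightarrow> 'm"
  BLoosenR :: "tightness \<Rightarrow> 'o list \<Rightarrow> 'o \<Rightarrow> 'm \<Rightarrow> 'm"
  BId :: "'o \<Rightarrow> 'm"
  BComp :: "tightness \<Rightarrow> tightness \<Rightarrow> 'o list \<Rightarrow> 'o list \<Rightarrow> 'o list \<Rightarrow> 'o \<Rightarrow> 'o \<Rightarrow> 'm \<Rightarrow> 'm \<Rightarrow> 'm"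

text \<open>A tight-tight morphism, loosened to the required tightness on either side:\<close>

definition BLoosen_to ::
  "('o, 'm) biskew_multicat \<Rightarrow> tightness \<Rightarrow> tightness \<Rightarrow> 'o list \<Rightarrow> 'o \<Rightarrow> 'm \<Rightarrow> 'm" where
  "BLoosen_to C p q as x f =
     (case (p, q) of
        (Tight, Tight) \<Rightarrow> f
      | (Loose, Tight) \<Rightarrow> BLoosenL C Tight as x f
      | (Tight, Loose) \<Rightarrow> BLoosenR C Tight as x f
      | (Loose, Loose) \<Rightarrow> BLoosenL C Loose as x (BLoosenR C Tight as x f))"

locale biskew_multicategory =
  fixes C :: "('o, 'm) biskew_multicat"
  assumes hom_obj: "f \<in> BHom C p q as x \<Longrightarrow> set as \<subseteq> BObj C \<and> x \<in> BObj C"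
    and tight_nonempty: "\<lbrakk>f \<in> BHom C p q as x; p = Tight \<or> q = Tight\<rbrakk> \<Longrightarrow> as \<noteq> []"
    and loosenL_hom: "f \<in> BHom C Tight q as x \<Longrightarrow> BLoosenL C q as x f \<in> BHom C Loose q as x"
    and loosenR_hom: "f \<in> BHom C p Tight as x \<Longrightarrow> BLoosenR C p as x f \<in> BHom C p Loose as x"
    and id_hom: "x \<in> BObj C \<Longrightarrow> BId C x \<in> BHom C Tight Tight [x] x"
    and comp_hom: "\<lbrakk>g \<in> BHom C p q (as @ x # cs) y;
            f \<in> BHom C (at_input p as) (at_input q cs) bs x\<rbrakk>
          \<Longrightarrow> BComp C p q as bs cs x y g f \<in> BHom C p q (as @ bs @ cs) y"
    and loosen_commute: "f \<in> BHom C Tight Tight as x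
          \<Longrightarrow> BLoosenL C Loose as x (BLoosenR C Tight as x f)
            = BLoosenR C Loose as x (BLoosenL C Tight as x f)"
    and loosenL_comp: "\<lbrakk>g \<in> BHom C Tight q (as @ x # cs) y;
            f \<in> BHom C (at_input Tight as) (at_input q cs) bs x\<rbrakk>
          \<Longrightarrow> BLoosenL C q (as @ bs @ cs) y (BComp C Tight q as bs cs x y g f)
            = BComp C Loose q as bs cs x y (BLoosenL C q (as @ x # cs) y g)
                (if as = [] then BLoosenL C (at_input q cs) bs x f else f)"
    and loosenR_comp: "\<lbrakk>g \<in> BHom C p Tight (as @ x # cs) y;
            f \<in> BHom C (at_input p as) (at_input Tight cs) bs x\<rbrakk>
          \<Longrightarrow> BLoosenR C p (as @ bs @ cs) y (BComp C p Tight as bs cs x y g f)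
            = BComp C p Loose as bs cs x y (BLoosenR C p (as @ x # cs) y g)
                (if cs = [] then BLoosenR C (at_input p as) bs x f else f)"
    and assoc: "\<lbrakk>h \<in> BHom C p q (ds @ y # es) z;
            g \<in> BHom C (at_input p ds) (at_input q es) (as @ x # cs) y;
            f \<in> BHom C (at_input (at_input p ds) as) (at_input (at_input q es) cs) bs x\<rbrakk>
          \<Longrightarrow> BComp C p q ds (as @ bs @ cs) es y z h
                (BComp C (at_input p ds) (at_input q es) as bs cs x y g f)
            = BComp C p q (ds @ as) bs (cs @ es) x z
                (BComp C p q ds (as @ x # cs) es y z h g) f"
    and interchange: "\<lbrakk>h \<in> BHom C p q (as @ x # bs @ y # cs) z;
            f \<in> BHom C (at_input p as) (at_input q (bs @ y # cs)) ds x;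
            g \<in> BHom C (at_input p (as @ x # bs)) (at_input q cs) es y\<rbrakk>
          \<Longrightarrow> BComp C p q (as @ ds @ bs) es cs y z (BComp C p q as ds (bs @ y # cs) x z h f) g
            = BComp C p q as ds (bs @ es @ cs) x z (BComp C p q (as @ x # bs) es cs y z h g) f"
    and comp_id: "g \<in> BHom C p q (as @ x # cs) y
          \<Longrightarrow> BComp C p q as [x] cs x y g
                (BLoosen_to C (at_input p as) (at_input q cs) [x] x (BId C x)) = g"
    and id_comp: "f \<in> BHom C p q bs x
          \<Longrightarrow> BComp C p q [] bs [] x x (BLoosen_to C p q [x] x (BId C x)) f = f"

record ('o, 'm, 'p, 'n) biskew_map =
  bobj :: "'o \<Rightarrow> 'p"
  bhom :: "tightness \<Rightarrow> tightness \<Rightarrow> 'o list \<Rightarrow> 'o \<Rightarrow> 'm \<Rightarrow> 'n"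

definition is_biskew_map ::
  "('o, 'm) biskew_multicat \<Rightarrow> ('p, 'n) biskew_multicat
     \<Rightarrow> ('o, 'm, 'p, 'n) biskew_map \<Rightarrow> bool" where
  "is_biskew_map C D F \<longleftrightarrow>
     bobj F \<in> BObj C \<rightarrow>\<^sub>E BObj D \<and>
     (\<forall>p q as x.
        bhom F p q as x \<in> BHom C p q as x \<rightarrow>\<^sub>E BHom D p q (map (bobj F) as) (bobj F x)) \<and>
     (\<forall>q as x. \<forall>f\<in>BHom C Tight q as x.
        bhom F Loose q as x (BLoosenL C q as x f)
        = BLoosenL D q (map (bobj F) as) (bobj F x) (bhom F Tight q as x f)) \<and>
     (\<forall>p as x. \<forall>f\<in>BHom C p Tight as x.
        bhom F p Loose as x (BLoosenR C p as x f)
        = BLoosenR D p (map (bobj F) as) (bobj F x) (bhom F p Tight as x f)) \<and>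
     (\<forall>x\<in>BObj C. bhom F Tight Tight [x] x (BId C x) = BId D (bobj F x)) \<and>
     (\<forall>p q as bs cs x y. \<forall>g\<in>BHom C p q (as @ x # cs) y.
        \<forall>f\<in>BHom C (at_input p as) (at_input q cs) bs x.
        bhom F p q (as @ bs @ cs) y (BComp C p q as bs cs x y g f)
        = BComp D p q (map (bobj F) as) (map (bobj F) bs) (map (bobj F) cs) (bobj F x) (bobj F y)
            (bhom F p q (as @ x # cs) y g)
            (bhom F (at_input p as) (at_input q cs) bs x f))"

primrec BComps ::
  "('o, 'm) biskew_multicat \<Rightarrow> tightness \<Rightarrow> tightness \<Rightarrow> 'o list \<Rightarrow> ('o \<times> 'o \<times> 'm) list
     \<Rightarrow> 'o \<Rightarrow> 'm \<Rightarrow> 'm" where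
  "BComps C p q pre [] y g = g"
| "BComps C p q pre (t # ts) y g = (case t of (a, b, f) \<Rightarrow>
     BComps C p q (pre @ [a]) ts y
       (BComp C p q pre [a] (map (fst \<circ> snd) ts) b y g
          (BLoosen_to C (at_input p pre) (at_input q ts) [a] b f)))"

definition is_biskew_cell ::
  "('o, 'm) biskew_multicat \<Rightarrow> ('p, 'n) biskew_multicat \<Rightarrow> ('o, 'm, 'p, 'n) biskew_map
     \<Rightarrow> ('o, 'm, 'p, 'n) biskew_map \<Rightarrow> ('o \<Rightarrow> 'n) \<Rightarrow> bool" where
  "is_biskew_cell C D F G \<alpha> \<longleftrightarrow>
     \<alpha> \<in> extensional (BObj C) \<and>
     (\<forall>x\<in>BObj C. \<alpha> x \<in> BHom D Tight Tight [bobj F x] (bobj G x)) \<and>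
     (\<forall>p q as b. \<forall>f\<in>BHom C p q as b.
        BComp D p q [] (map (bobj F) as) [] (bobj F b) (bobj G b)
          (BLoosen_to D p q [bobj F b] (bobj G b) (\<alpha> b)) (bhom F p q as b f)
        = BComps D p q [] (map (\<lambda>a. (bobj F a, bobj G a, \<alpha> a)) as) (bobj G b)
            (bhom G p q as b f))"

definition biskew_hom_category ::
  "('o, 'm) biskew_multicat \<Rightarrow> ('p, 'n) biskew_multicat
     \<Rightarrow> (('o, 'm, 'p, 'n) biskew_map, 'o \<Rightarrow> 'n) cat" where
  "biskew_hom_category C D = \<lparr>
     Ob = {F. is_biskew_map C D F},
     Arr = (\<lambda>F G. {\<alpha>. is_biskew_cell C D F G \<alpha>}),
     Ident = (\<lambda>F. \<lambda>x\<in>BObj C. BId D (bobj F x)),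
     Compose = (\<lambda>F G H \<beta> \<alpha>. \<lambda>x\<in>BObj C.
       BComp D Tight Tight [] [bobj F x] [] (bobj G x) (bobj H x) (\<beta> x) (\<alpha> x)) \<rparr>"

definition terminal_biskew :: "(unit, unit) biskew_multicat" where
  "terminal_biskew = \<lparr>
     BObj = UNIV,
     BHom = (\<lambda>p q as x. if (p = Tight \<or> q = Tight) \<and> as = [] then {} else UNIV),
     BLoosenL = (\<lambda>q as x f. ()),
     BLoosenR = (\<lambda>p as x f. ()),
     BId = (\<lambda>x. ()),
     BComp = (\<lambda>p q as bs cs x y g f. ()) \<rparr>"

lemma biskew_multicategory_terminal: "biskew_multicategory terminal_biskew"
  by unfold_locales (auto simp: terminal_biskew_def at_input_def split: if_splits)

definition is_biskew_monoid :: "('o, 'm) biskew_multicat \<Rightarrow> 'o \<times> 'm \<times> 'm \<Rightarrow> bool" where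
  "is_biskew_monoid C = (\<lambda>(x, m, e).
     x \<in> BObj C \<and> m \<in> BHom C Tight Tight [x, x] x \<and> e \<in> BHom C Loose Loose [] x \<and>
     BComp C Loose Tight [] [] [x] x x (BLoosenL C Tight [x, x] x m) e
     = BLoosenL C Tight [x] x (BId C x) \<and>
     BComp C Tight Loose [x] [] [] x x (BLoosenR C Tight [x, x] x m) e
     = BLoosenR C Tight [x] x (BId C x) \<and>
     BComp C Tight Tight [] [x, x] [x] x x m (BLoosenR C Tight [x, x] x m)
     = BComp C Tight Tight [x] [x, x] [] x x m (BLoosenL C Tight [x, x] x m))"

definition is_biskew_monoid_hom ::
  "('o, 'm) biskew_multicat \<Rightarrow> 'o \<times> 'm \<times> 'm \<Rightarrow> 'o \<times> 'm \<times> 'm \<Rightarrow> 'm \<Rightarrow> bool" where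
  "is_biskew_monoid_hom C = (\<lambda>(x, m, e) (y, n, u) f.
     f \<in> BHom C Tight Tight [x] y \<and>
     BComp C Loose Loose [] [] [] x y (BLoosen_to C Loose Loose [x] y f) e = u \<and>
     BComp C Tight Tight [] [x, x] [] x y f m
     = BComps C Tight Tight [] [(x, y, f), (x, y, f)] y n)"

definition biskew_Mon :: "('o, 'm) biskew_multicat \<Rightarrow> ('o \<times> 'm \<times> 'm, 'm) cat" where
  "biskew_Mon C = \<lparr>
     Ob = {M. is_biskew_monoid C M},
     Arr = (\<lambda>M N. {f. is_biskew_monoid_hom C M N f}),
     Ident = (\<lambda>(x, m, e). BId C x),
     Compose = (\<lambda>(x, _) (y, _) (z, _) g f. BComp C Tight Tight [] [x] [] y z g f) \<rparr>"

definition biskew_UnbiasMon ::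
  "('o, 'm) biskew_multicat \<Rightarrow> ((unit, unit, 'o, 'm) biskew_map, unit \<Rightarrow> 'm) cat" where
  "biskew_UnbiasMon C = biskew_hom_category terminal_biskew C"

definition biskew_biased_counterpart :: "(unit, unit, 'o, 'm) biskew_map \<Rightarrow> 'o \<times> 'm \<times> 'm" where
  "biskew_biased_counterpart F =
     (bobj F (), bhom F Tight Tight [(), ()] () (), bhom F Loose Loose [] () ())"


text \<open>A 2-cell between maps out of the terminal object is determined by its only component, which is
  the homomorphism in question.\<close>

definition the_component :: "'F \<Rightarrow> 'F \<Rightarrow> (unit \<Rightarrow> 'm) \<Rightarrow> 'm" where
  "the_component F G \<alpha> = \<alpha> ()"

end

theory Submission
  imports Defs
begin

text \<open>Everything is reduced to the bi-skew case: a multicategory is a left-skew multicategory whose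
  tight morphisms are its loose morphisms with nonempty source, and a left-skew multicategory is in
  the same way a bi-skew one; the monoids and the unbiased monoids do not change.

  In a bi-skew multicategory, the unit and composition conditions on an unbiased monoid force
  \<open>m\<^sup>p\<^sup>q\<^sub>1\<close> to be the loosened identity and
  \<open>m\<^sup>p\<^sup>q\<^sub>n\<^sub>+\<^sub>1 = m\<^sup>p\<^sup>q\<^sub>2 \<circ> m\<^sup>p\<^sup>L\<^sub>n\<close> (at the first input) for \<open>n > 0\<close>, which gives
  uniqueness. Conversely, the left-nested products defined by this recursion from a monoid are
  closed under composition. An inner product plugged into any input but the last is absorbed by the
  recursion and associativity of composition. At the last input, interchange leaves
  \<open>m\<^sub>2 \<circ> (m\<^sub>i, m\<^sub>k) = m\<^sub>i\<^sub>+\<^sub>k\<close>, which follows by induction on \<open>k\<close> from the associativity axiom of the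
  monoid. A homomorphism is compatible with \<open>m\<^sub>n\<close> by induction along the same recursion.\<close>

section \<open>Tightness at an input position\<close>

lemma at_input_simps [simp]:
  "at_input p [] = p" "at_input p (a # as) = Loose" "at_input Loose as = Loose"
  "at_input p (as @ bs) = at_input (at_input p as) bs"
  by (simp_all add: at_input_def)

text \<open>For copies of a single object only the number of neighbouring inputs matters, so this is
  \<open>at_input\<close> read on lengths of lists.\<close>

definition at_pos :: "tightness \<Rightarrow> nat \<Rightarrow> tightness" where
  "at_pos p n = (if n = 0 then p else Loose)"

lemma at_pos_simps [simp]:
  "at_pos p 0 = p" "at_pos p (Suc n) = Loose" "n > 0 \<Longrightarrow> at_pos p n = Loose"
  "at_pos Loose n = Loose" "at_pos (at_pos p i) j = at_pos p (i + j)"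
  by (simp_all add: at_pos_def)

lemma at_input_replicate [simp]: "at_input p (replicate n a) = at_pos p n"
  by (simp add: at_input_def at_pos_def)

lemma at_input_at_pos [simp]: "at_input (at_pos q n) as = at_pos (at_input q as) n"
  by (simp add: at_input_def at_pos_def)

text \<open>Displays a chosen occurrence of \<open>a\<close> in the shape \<open>as @ x # cs\<close>
  in which the axioms of composition are stated.\<close>

lemma replicate_Suc_add: "replicate (Suc (i + j)) a = replicate i a @ a # replicate j a"
  by (simp add: replicate_add replicate_app_Cons_same)

lemma unit_listE:
  fixes as :: "unit list"
  obtains n where "as = replicate n ()"
  by (metis replicate_length_same unit.exhaust)

section \<open>Loosening of composites, and composition on powers of one object\<close>

context biskew_multicategory
begin

lemma BLoosen_to_hom:
  "f \<in> BHom C Tight Tight as y \<Longrightarrow> BLoosen_to C p q as y f \<in> BHom C p q as y"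
  by (cases p; cases q) (auto simp: BLoosen_to_def intro: loosenL_hom loosenR_hom)

lemma BLoosen_to_Tight [simp]: "BLoosen_to C Tight Tight as y f = f"
  by (simp add: BLoosen_to_def)

lemma BLoosenL_BLoosen_to:
  "BLoosenL C q as y (BLoosen_to C Tight q as y f) = BLoosen_to C Loose q as y f"
  by (cases q) (simp_all add: BLoosen_to_def)

lemma BLoosenR_BLoosen_to:
  "f \<in> BHom C Tight Tight as y \<Longrightarrow>
    BLoosenR C p as y (BLoosen_to C p Tight as y f) = BLoosen_to C p Loose as y f"
  by (cases p) (simp_all add: BLoosen_to_def loosen_commute)

text \<open>Each tightness is reached from tight-tight by loosening first on the right and then on
  the left, as far as required, and both steps commute with composition. Equations between
  tight-tight composites can thus be carried to all four tightnesses.\<close>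

lemma BLoosen_to_comp:
  assumes g: "g \<in> BHom C Tight Tight (as @ y # cs) z" and f: "f \<in> BHom C Tight Tight bs y"
  shows "BLoosen_to C p q (as @ bs @ cs) z (BComp C Tight Tight as bs cs y z g
             (BLoosen_to C (at_input Tight as) (at_input Tight cs) bs y f))
       = BComp C p q as bs cs y z (BLoosen_to C p q (as @ y # cs) z g)
             (BLoosen_to C (at_input p as) (at_input q cs) bs y f)"
proof -
  let ?gf = "\<lambda>p q. BComp C p q as bs cs y z (BLoosen_to C p q (as @ y # cs) z g)
             (BLoosen_to C (at_input p as) (at_input q cs) bs y f)"
  have L: "BLoosenL C q (as @ bs @ cs) z (?gf Tight q) = ?gf Loose q" for q
    using loosenL_comp[OF BLoosen_to_hom[OF g, of Tight q] BLoosen_to_hom[OF f]]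
    by (cases "as = []") (simp_all add: BLoosenL_BLoosen_to at_input_def)
  have R: "BLoosenR C p (as @ bs @ cs) z (?gf p Tight) = ?gf p Loose" for p
    using loosenR_comp[OF BLoosen_to_hom[OF g, of p Tight] BLoosen_to_hom[OF f]]
    using g f by (cases "cs = []") (simp_all add: BLoosenR_BLoosen_to at_input_def)
  show ?thesis
    using L[of Loose] L[of Tight] R[of Tight]
    by (cases p; cases q) (simp_all add: BLoosen_to_def[of C _ _ "as @ bs @ cs"])
qed

definition hom_pow :: "'o \<Rightarrow> tightness \<Rightarrow> tightness \<Rightarrow> nat \<Rightarrow> 'm set" where
  "hom_pow x p q n = BHom C p q (replicate n x) x"

text \<open>The numbers \<open>i k j\<close> count the inputs before, inside and after the
  plugged-in morphism, so associativity and interchange turn into laws about arities.\<close>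

definition comp_pow :: "'o \<Rightarrow> tightness \<Rightarrow> tightness \<Rightarrow> nat \<Rightarrow> nat \<Rightarrow> nat \<Rightarrow> 'm \<Rightarrow> 'm \<Rightarrow> 'm" where
  "comp_pow x p q i k j = BComp C p q (replicate i x) (replicate k x) (replicate j x) x x"

lemma comp_pow_hom:
  "\<lbrakk>g \<in> hom_pow x p q (Suc (i + j)); f \<in> hom_pow x (at_pos p i) (at_pos q j) k\<rbrakk>
    \<Longrightarrow> comp_pow x p q i k j g f \<in> hom_pow x p q (i + k + j)"
  using comp_hom[of g p q "replicate i x" x "replicate j x" x f "replicate k x"]
  unfolding hom_pow_def comp_pow_def replicate_Suc_add by (simp add: replicate_add)

lemma comp_pow_assoc:
  "\<lbrakk>h \<in> hom_pow x p q (Suc (d + e)); g \<in> hom_pow x (at_pos p d) (at_pos q e) (Suc (a + b));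
    f \<in> hom_pow x (at_pos p (d + a)) (at_pos q (e + b)) k\<rbrakk>
   \<Longrightarrow> comp_pow x p q d (a + k + b) e h (comp_pow x (at_pos p d) (at_pos q e) a k b g f)
     = comp_pow x p q (d + a) k (b + e) (comp_pow x p q d (Suc (a + b)) e h g) f"
  using assoc[of h p q "replicate d x" x "replicate e x" x g "replicate a x" x "replicate b x" f
      "replicate k x"]
  unfolding hom_pow_def comp_pow_def replicate_Suc_add by (simp add: replicate_add)

text \<open>The input of \<open>f\<close> lies to the left of that of \<open>g\<close>, so
  \<open>f\<close> is loose on the right and \<open>g\<close> is loose on the left.\<close>

lemma comp_pow_interchange:
  "\<lbrakk>h \<in> hom_pow x p q (Suc (i + Suc (j + l))); f \<in> hom_pow x (at_pos p i) Loose r;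
    g \<in> hom_pow x Loose (at_pos q l) s\<rbrakk>
   \<Longrightarrow> comp_pow x p q (i + r + j) s l (comp_pow x p q i r (Suc (j + l)) h f) g
     = comp_pow x p q i r (j + s + l) (comp_pow x p q (Suc (i + j)) s l h g) f"
  using interchange[of h p q "replicate i x" x "replicate j x" x "replicate l x" x f
      "replicate r x" g "replicate s x"]
  unfolding hom_pow_def comp_pow_def replicate_Suc_add by (simp add: replicate_add)

lemma comp_identity:
  "g \<in> hom_pow x p q (Suc (i + j)) \<Longrightarrow>
    comp_pow x p q i 1 j g (BLoosen_to C (at_pos p i) (at_pos q j) [x] x (BId C x)) = g"
  using comp_id[of g p q "replicate i x" x "replicate j x" x]
  unfolding hom_pow_def comp_pow_def replicate_Suc_add by simp

lemma identity_comp: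
  "f \<in> hom_pow x p q k \<Longrightarrow> comp_pow x p q 0 k 0 (BLoosen_to C p q [x] x (BId C x)) f = f"
  using id_comp[of f p q "replicate k x" x] unfolding hom_pow_def comp_pow_def by simp

end

section \<open>Left-nested products in a bi-skew monoid\<close>

locale biskew_monoid = biskew_multicategory C
  for C :: "('o, 'm) biskew_multicat" +
  fixes x :: 'o and m e :: 'm
  assumes mon: "is_biskew_monoid C (x, m, e)"
begin

definition iota :: "tightness \<Rightarrow> tightness \<Rightarrow> 'm" where
  "iota p q = BLoosen_to C p q [x] x (BId C x)"

definition mu :: "tightness \<Rightarrow> tightness \<Rightarrow> 'm" where
  "mu p q = BLoosen_to C p q [x, x] x m"

lemma x_obj: "x \<in> BObj C" and m_hom: "m \<in> BHom C Tight Tight [x, x] x"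
  and e_hom: "e \<in> BHom C Loose Loose [] x"
  using mon by (simp_all add: is_biskew_monoid_def)

lemma iota_hom: "iota p q \<in> hom_pow x p q 1"
  using BLoosen_to_hom[OF id_hom[OF x_obj]] by (simp add: iota_def hom_pow_def)

lemma mu_hom: "mu p q \<in> hom_pow x p q 2"
  using BLoosen_to_hom[OF m_hom] by (simp add: mu_def hom_pow_def numeral_2_eq_2)

text \<open>The unit axiom is the loose-tight case, and loosening it on the right gives the
  loose-loose case. On the left only \<open>Loose\<close> can occur, since the loose
  \<open>e\<close> fills the first input.\<close>

lemma mu_unit_left: "comp_pow x Loose q 0 0 1 (mu Loose q) e = iota Loose q"
proof (cases q)
  case Tight
  then show ?thesis
    using mon by (simp add: is_biskew_monoid_def comp_pow_def mu_def iota_def BLoosen_to_def)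
next
  case Loose
  have "BComp C Loose Tight [] [] [x] x x (BLoosenL C Tight [x, x] x m) e
     = BLoosenL C Tight [x] x (BId C x)"
    using mon by (simp add: is_biskew_monoid_def)
  \<comment> \<open>\<open>BLoosen_to\<close> loosens on the right before the left; the order here
    is the reverse, which \<open>loosen_commute\<close> repairs.\<close>
  then show ?thesis
    using loosenR_comp[of "BLoosenL C Tight [x, x] x m" Loose "[]" x "[x]" x e "[]"]
      loosenL_hom[OF m_hom] e_hom loosen_commute[OF m_hom] loosen_commute[OF id_hom[OF x_obj]]
      Loose
    by (simp add: comp_pow_def mu_def iota_def BLoosen_to_def)
qed

text \<open>Mirror image: the axiom is the tight-loose case, and loosening it on the left gives the
  other one.\<close>

lemma mu_unit_right: "comp_pow x p Loose 1 0 0 (mu p Loose) e = iota p Loose"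
proof (cases p)
  case Tight
  then show ?thesis
    using mon by (simp add: is_biskew_monoid_def comp_pow_def mu_def iota_def BLoosen_to_def)
next
  case Loose
  have "BComp C Tight Loose [x] [] [] x x (BLoosenR C Tight [x, x] x m) e
     = BLoosenR C Tight [x] x (BId C x)"
    using mon by (simp add: is_biskew_monoid_def)
  then show ?thesis
    using loosenL_comp[of "BLoosenR C Tight [x, x] x m" Loose "[x]" x "[]" x e "[]"]
      loosenR_hom[OF m_hom] e_hom Loose
    by (simp add: comp_pow_def mu_def iota_def BLoosen_to_def)
qed

text \<open>The monoid axiom is the tight-tight case; \<open>BLoosen_to_comp\<close>, applied to
  both sides, carries it to every pair of tightnesses.\<close>

lemma mu_assoc:
  "comp_pow x p q 0 2 1 (mu p q) (mu p Loose) = comp_pow x p q 1 2 0 (mu p q) (mu Loose q)"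
proof -
  have "BComp C Tight Tight [] [x, x] [x] x x m (BLoosen_to C Tight Loose [x, x] x m)
      = BComp C Tight Tight [x] [x, x] [] x x m (BLoosen_to C Loose Tight [x, x] x m)"
    using mon by (simp add: is_biskew_monoid_def BLoosen_to_def)
  then show ?thesis
    using BLoosen_to_comp[of m "[]" x "[x]" x m "[x, x]" p q]
      BLoosen_to_comp[of m "[x]" x "[]" x m "[x, x]" p q] m_hom
    by (simp add: comp_pow_def mu_def numeral_2_eq_2)
qed

text \<open>The inner product is loose on the right because one more input follows it. Arity 1 is a
  separate base case, as the loose \<open>e\<close> cannot fill a tight first input. The value
  \<open>e\<close> at arity 0 is a mere default unless \<open>p\<close> and \<open>q\<close> are
  both loose.\<close>

fun mult :: "tightness \<Rightarrow> tightness \<Rightarrow> nat \<Rightarrow> 'm" where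
  "mult p q 0 = e"
| "mult p q (Suc 0) = iota p q"
| "mult p q (Suc (Suc n)) = comp_pow x p q 0 (Suc n) 1 (mu p q) (mult p Loose (Suc n))"

lemma mult_Suc:
  "n > 0 \<Longrightarrow> mult p q (Suc n) = comp_pow x p q 0 n 1 (mu p q) (mult p Loose n)"
  by (cases n) simp_all

lemma mult_hom: "n > 0 \<or> p = Loose \<and> q = Loose \<Longrightarrow> mult p q n \<in> hom_pow x p q n"
proof (induction p q n rule: mult.induct)
  case (1 p q)
  then show ?case using e_hom by (simp add: hom_pow_def)
next
  case (2 p q)
  then show ?case using iota_hom by simp
next
  case (3 p q n)
  then show ?case
    using comp_pow_hom[of "mu p q" x p q 0 1 "mult p Loose (Suc n)" "Suc n"] mu_hom
    by (simp add: numeral_2_eq_2)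
qed

lemma mult_2: "mult p q 2 = mu p q"
  using comp_identity[of "mu p q" x p q 0 1] mu_hom[of p q]
  by (simp add: numeral_2_eq_2 iota_def)

text \<open>This is \<open>m_2\<close> applied to \<open>m_i\<close> and \<open>m_k\<close>, with
  the last input filled first. The product \<open>m_k\<close> carries the right tightness
  \<open>q\<close>, so \<open>k = 0\<close> is possible only for \<open>q = Loose\<close>. Arity 0
  is the right unit law and arity 1 an identity law; for larger \<open>k\<close> one factor is
  peeled off \<open>m_k\<close> and the rest is rebracketed by \<open>mu_assoc\<close>.\<close>

lemma mult_comp_mu:
  assumes "i > 0" and "k > 0 \<or> q = Loose"
  shows "comp_pow x p q 0 i k (comp_pow x p q 1 k 0 (mu p q) (mult Loose q k)) (mult p Loose i)
       = mult p q (i + k)"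
  using assms(2)
proof (induction k arbitrary: q rule: induct_nat_012)
  case 0
  then show ?case
    using mu_unit_right[of p] identity_comp[of "mult p Loose i" x p Loose i] mult_hom[of i p Loose]
      assms(1) by (simp add: iota_def)
next
  case 1
  have "comp_pow x p q 1 1 0 (mu p q) (iota Loose q) = mu p q"
    using comp_identity[of "mu p q" x p q 1 0] mu_hom by (simp add: iota_def numeral_2_eq_2)
  then show ?case using assms(1) by (simp add: mult_Suc)
next
  case (ge2 n)
  let ?k = "Suc n"
  let ?M = "mult Loose Loose ?k"
  have M: "?M \<in> hom_pow x Loose Loose ?k" and Mi: "mult p Loose i \<in> hom_pow x p Loose i"
    using mult_hom assms(1) by auto
  have mu2: "mu r s \<in> hom_pow x r s (Suc (Suc 0))" for r s using mu_hom by (simp add: numeral_2_eq_2)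
  have "comp_pow x p q 1 (Suc ?k) 0 (mu p q) (mult Loose q (Suc ?k))
      = comp_pow x p q 1 (Suc ?k) 0 (mu p q) (comp_pow x Loose q 0 ?k 1 (mu Loose q) ?M)"
    by simp
  also have "\<dots> = comp_pow x p q 1 ?k 1 (comp_pow x p q 1 2 0 (mu p q) (mu Loose q)) ?M"
    using comp_pow_assoc[of "mu p q" x p q 1 0 "mu Loose q" 0 1 ?M ?k] mu2 M
    by (simp add: numeral_2_eq_2)
  also have "\<dots> = comp_pow x p q 1 ?k 1 (comp_pow x p q 0 2 1 (mu p q) (mu p Loose)) ?M"
    using mu_assoc[of p q] by simp
  \<comment> \<open>The inner composite has one factor fewer and is loose on the right, which is why
    \<open>q\<close> varies in the induction.\<close>
  also have "\<dots> = comp_pow x p q 0 (Suc ?k) 1 (mu p q) (comp_pow x p Loose 1 ?k 0 (mu p Loose) ?M)"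
    using comp_pow_assoc[of "mu p q" x p q 0 1 "mu p Loose" 1 0 ?M ?k] mu2 M
    by (simp add: numeral_2_eq_2)
  finally have "comp_pow x p q 0 i (Suc ?k) (comp_pow x p q 1 (Suc ?k) 0 (mu p q) (mult Loose q (Suc ?k)))
        (mult p Loose i)
      = comp_pow x p q 0 i (Suc ?k)
          (comp_pow x p q 0 (Suc ?k) 1 (mu p q) (comp_pow x p Loose 1 ?k 0 (mu p Loose) ?M))
          (mult p Loose i)"
    by simp
  \<comment> \<open>The product \<open>mult p Loose i\<close> moves into the first factor, producing
    the left side of the induction hypothesis.\<close>
  also have "\<dots> = comp_pow x p q 0 (i + ?k) 1 (mu p q)
      (comp_pow x p Loose 0 i ?k (comp_pow x p Loose 1 ?k 0 (mu p Loose) ?M) (mult p Loose i))"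
    using comp_pow_assoc[of "mu p q" x p q 0 1 "comp_pow x p Loose 1 ?k 0 (mu p Loose) ?M" 0 ?k
        "mult p Loose i" i] mu2 comp_pow_hom[of "mu p Loose" x p Loose 1 0 ?M ?k] M Mi
    by simp
  also have "\<dots> = comp_pow x p q 0 (i + ?k) 1 (mu p q) (mult p Loose (i + ?k))"
    using ge2.IH(2)[of Loose] by simp
  also have "\<dots> = mult p q (i + Suc ?k)"
    using mult_Suc[of "i + ?k" p q] by simp
  finally show ?case .
qed

text \<open>Induction on the number \<open>j\<close> of inputs after the plugged-in product. For
  \<open>j > 0\<close> the composition takes place within the inner product, which is loose on the
  right; hence \<open>q\<close> is arbitrary. For \<open>j = 0\<close> the input being filled is the
  last one.\<close>

lemma mult_comp:
  assumes "k > 0 \<or> at_pos p i = Loose \<and> at_pos q j = Loose"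
  shows "comp_pow x p q i k j (mult p q (Suc (i + j))) (mult (at_pos p i) (at_pos q j) k)
       = mult p q (i + k + j)"
  using assms
proof (induction j arbitrary: q)
  case 0
  then have M: "mult (at_pos p i) q k \<in> hom_pow x (at_pos p i) q k" by (auto intro!: mult_hom)
  show ?case
  proof (cases "i = 0")
    case True
    then show ?thesis using M identity_comp[of "mult p q k" x p q k] by (simp add: iota_def)
  next
    case False
    have "comp_pow x p q i k 0 (comp_pow x p q 0 i 1 (mu p q) (mult p Loose i)) (mult Loose q k)
        = comp_pow x p q 0 i k (comp_pow x p q 1 k 0 (mu p q) (mult Loose q k)) (mult p Loose i)"
      using comp_pow_interchange[of "mu p q" x p q 0 0 0 "mult p Loose i" i "mult Loose q k" k]
        mu_hom[of p q] mult_hom[of i p Loose] M False by (simp add: numeral_2_eq_2)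
    then show ?thesis using False 0 mult_comp_mu[of i k q p] by (simp add: mult_Suc)
  qed
next
  case (Suc j)
  then have M: "mult (at_pos p i) Loose k \<in> hom_pow x (at_pos p i) Loose k" by (auto intro!: mult_hom)
  have "comp_pow x p q i k (Suc j) (mult p q (Suc (i + Suc j))) (mult (at_pos p i) Loose k)
      = comp_pow x p q 0 (i + k + j) 1 (mu p q)
          (comp_pow x p Loose i k j (mult p Loose (Suc (i + j))) (mult (at_pos p i) Loose k))"
    using comp_pow_assoc[of "mu p q" x p q 0 1 "mult p Loose (Suc (i + j))" i j
        "mult (at_pos p i) Loose k" k] mu_hom[of p q] mult_hom[of "Suc (i + j)" p Loose] M
    by (simp add: numeral_2_eq_2)
  also have "\<dots> = comp_pow x p q 0 (i + k + j) 1 (mu p q) (mult p Loose (i + k + j))"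
    using Suc.IH[of Loose] Suc.prems by simp
  also have "\<dots> = mult p q (i + k + Suc j)"
  proof (cases "i + k + j = 0")
    \<comment> \<open>The inner product of arity 0 is \<open>e\<close>, to which
      \<open>mult_Suc\<close> does not apply; the premises force \<open>p = Loose\<close>, so the
      left unit law does.\<close>
    case True
    then show ?thesis using Suc.prems mu_unit_left by simp
  next
    case False
    then show ?thesis using mult_Suc[of "i + k + j" p q] by simp
  qed
  finally show ?case by simp
qed

text \<open>The recursion for \<open>mult\<close> keeps the left tightness, so loosening passes both
  to \<open>mu\<close> and to the inner product at its first input.\<close>

lemma mult_loosenL:
  "n > 0 \<Longrightarrow> BLoosenL C q (replicate n x) x (mult Tight q n) = mult Loose q n"
proof (induction Tight q n rule: mult.induct)
  case (2 q)
  then show ?case by (simp add: iota_def BLoosenL_BLoosen_to)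
next
  case (3 q n)
  then show ?case
    using loosenL_comp[of "mu Tight q" q "[]" x "[x]" x "mult Tight Loose (Suc n)" "replicate (Suc n) x"]
      mu_hom[of Tight q] mult_hom[of "Suc n" Tight Loose]
    by (simp add: mu_def BLoosenL_BLoosen_to comp_pow_def hom_pow_def numeral_2_eq_2 replicate_append_same)
qed simp

text \<open>In the recursion only the outer \<open>mu\<close> changes: the inner product is not at
  the last input and is already loose on the right.\<close>

lemma mult_loosenR:
  "n > 0 \<Longrightarrow> BLoosenR C p (replicate n x) x (mult p Tight n) = mult p Loose n"
proof (induction p Tight n rule: mult.induct)
  case (2 p)
  then show ?case by (simp add: iota_def BLoosenR_BLoosen_to id_hom x_obj)
next
  case (3 p n)
  then show ?case
    using loosenR_comp[of "mu p Tight" p "[]" x "[x]" x "mult p Loose (Suc n)" "replicate (Suc n) x"]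
      mu_hom[of p Tight] mult_hom[of "Suc n" p Loose]
    by (simp add: mu_def BLoosenR_BLoosen_to m_hom comp_pow_def hom_pow_def numeral_2_eq_2 replicate_append_same)
qed simp

end

section \<open>Unbiased monoids and their homomorphisms\<close>

context biskew_multicategory
begin

text \<open>An unbiased monoid with lists replaced by their lengths. The guards single out the
  hom-sets that are inhabited in the terminal object; values of \<open>M\<close> at arity 0 with a
  tight side are left free.\<close>

definition unbiased :: "'o \<Rightarrow> (tightness \<Rightarrow> tightness \<Rightarrow> nat \<Rightarrow> 'm) \<Rightarrow> bool" where
  "unbiased x M \<longleftrightarrow> x \<in> BObj C \<and>
     (\<forall>p q n. n > 0 \<or> p = Loose \<and> q = Loose \<longrightarrow> M p q n \<in> hom_pow x p q n) \<and>
     (\<forall>q n. n > 0 \<longrightarrow> BLoosenL C q (replicate n x) x (M Tight q n) = M Loose q n) \<and>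
     (\<forall>p n. n > 0 \<longrightarrow> BLoosenR C p (replicate n x) x (M p Tight n) = M p Loose n) \<and>
     M Tight Tight 1 = BId C x \<and>
     (\<forall>p q i k j. k > 0 \<or> at_pos p i = Loose \<and> at_pos q j = Loose \<longrightarrow>
        comp_pow x p q i k j (M p q (Suc (i + j))) (M (at_pos p i) (at_pos q j) k)
        = M p q (i + k + j))"

lemma unbiased_hom: "\<lbrakk>unbiased x M; n > 0 \<or> p = Loose \<and> q = Loose\<rbrakk> \<Longrightarrow> M p q n \<in> hom_pow x p q n"
  and unbiased_id: "unbiased x M \<Longrightarrow> M Tight Tight 1 = BId C x"
  and unbiased_comp: "\<lbrakk>unbiased x M; k > 0 \<or> at_pos p i = Loose \<and> at_pos q j = Loose\<rbrakk> \<Longrightarrow>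
        comp_pow x p q i k j (M p q (Suc (i + j))) (M (at_pos p i) (at_pos q j) k)
        = M p q (i + k + j)"
  unfolding unbiased_def by blast+

lemma unbiased_loosen:
  assumes "unbiased x M" "n > 0"
  shows "M p q n = BLoosen_to C p q (replicate n x) x (M Tight Tight n)"
  using assms by (cases p; cases q) (simp_all add: unbiased_def BLoosen_to_def)

lemma unbiased_Suc:
  assumes "unbiased x M" "n > 0"
  shows "M p q (Suc n) = comp_pow x p q 0 n 1 (M p q 2) (M p Loose n)"
  using unbiased_comp[of x M n p 0 q 1] assms by (simp add: numeral_2_eq_2)

text \<open>Values of positive arity are loosenings of tight-tight ones, and
  \<open>unbiased_Suc\<close> expresses each larger product through arity 2 and a smaller
  product.\<close>

lemma unbiased_unique:
  assumes M: "unbiased x M" and N: "unbiased x N"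
    and "M Tight Tight 2 = N Tight Tight 2" "M Loose Loose 0 = N Loose Loose 0"
    and "n > 0 \<or> p = Loose \<and> q = Loose"
  shows "M p q n = N p q n"
  using assms(5)
proof (induction n arbitrary: p q rule: induct_nat_012)
  case 0
  then show ?case using assms(4) by simp
next
  case 1
  then show ?case
    using unbiased_loosen[OF M, of 1 p q] unbiased_loosen[OF N, of 1 p q] unbiased_id[OF M]
      unbiased_id[OF N] by simp
next
  case (ge2 n)
  then show ?case
    using unbiased_Suc[OF M, of "Suc n" p q] unbiased_Suc[OF N, of "Suc n" p q]
      unbiased_loosen[OF M, of 2 p q] unbiased_loosen[OF N, of 2 p q] assms(3) by simp
qed

text \<open>Every monoid axiom is an instance of the composition law: the unit laws compute arity 1,
  and both sides of associativity are the product of arity 3.\<close>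

lemma unbiased_imp_monoid:
  assumes M: "unbiased x M"
  shows "is_biskew_monoid C (x, M Tight Tight 2, M Loose Loose 0)"
proof -
  have L: "BLoosenL C Tight (replicate n x) x (M Tight Tight n) = M Loose Tight n"
    and R: "BLoosenR C Tight (replicate n x) x (M Tight Tight n) = M Tight Loose n" if "n > 0" for n
    using M that by (simp_all add: unbiased_def)
  have "x \<in> BObj C" using M by (simp add: unbiased_def)
  then show ?thesis
    using L[of 1] R[of 1] L[of 2] R[of 2] unbiased_id[OF M]
      unbiased_hom[OF M, of 2 Tight Tight] unbiased_hom[OF M, of 0 Loose Loose]
      unbiased_comp[OF M, of 0 Loose 0 Tight 1] unbiased_comp[OF M, of 0 Tight 1 Loose 0]
      unbiased_comp[OF M, of 2 Tight 0 Tight 1] unbiased_comp[OF M, of 2 Tight 1 Tight 0]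
    by (simp add: is_biskew_monoid_def comp_pow_def hom_pow_def numeral_2_eq_2)
qed

text \<open>A list over \<open>unit\<close> is determined by its length, and each hom-set of the
  terminal object is a singleton or empty, so the data of a map form a family indexed by arities.
  The second conjunct is extensionality over the empty hom-sets.\<close>

lemma is_biskew_map_terminal_iff:
  "is_biskew_map terminal_biskew C F \<longleftrightarrow>
     unbiased (bobj F ()) (\<lambda>p q n. bhom F p q (replicate n ()) () ()) \<and>
     (\<forall>p q. p = Tight \<or> q = Tight \<longrightarrow> bhom F p q [] () = (\<lambda>_. undefined))"
proof -
  have unit_list: "(\<forall>as :: unit list. P as) \<longleftrightarrow> (\<forall>n. P (replicate n ()))" for P
    by (metis replicate_length_same unit.exhaust)
  have ne: "(p = Tight \<or> q = Tight) \<and> n = 0 \<longleftrightarrow> \<not> (n > 0 \<or> p = Loose \<and> q = Loose)" for p q and n :: nat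
    by (cases p; cases q) auto
  have hom: "bhom F p q (replicate n ()) () \<in> BHom terminal_biskew p q (replicate n ()) ()
        \<rightarrow>\<^sub>E BHom C p q (replicate n (bobj F ())) (bobj F ()) \<longleftrightarrow>
      (n > 0 \<or> p = Loose \<and> q = Loose \<longrightarrow> bhom F p q (replicate n ()) () () \<in> hom_pow (bobj F ()) p q n) \<and>
      ((p = Tight \<or> q = Tight) \<and> n = 0 \<longrightarrow> bhom F p q (replicate n ()) () = (\<lambda>_. undefined))" for p q n
    unfolding terminal_biskew_def hom_pow_def using ne[of p q n]
    by (auto simp: PiE_def extensional_def)
  have inhabited: "(\<forall>f\<in>BHom terminal_biskew p q (replicate n ()) (). Q f) \<longleftrightarrow>
      (n > 0 \<or> p = Loose \<and> q = Loose \<longrightarrow> Q ())" for p q n Q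
    unfolding terminal_biskew_def using ne[of p q n] by auto
  have unit_all: "(\<forall>u::unit. P u) \<longleftrightarrow> P ()" for P by auto
  have map_obj: "map (bobj F) (replicate n ()) = replicate n (bobj F ())" for n by simp
  have app: "replicate i () @ () # replicate j () = replicate (Suc (i + j)) ()"
    "replicate i () @ replicate k () @ replicate j () = replicate (i + k + j) ()" for i j k
    by (simp_all add: replicate_Suc_add replicate_add del: replicate_Suc)
  have obj: "bobj F \<in> BObj terminal_biskew \<rightarrow>\<^sub>E BObj C \<longleftrightarrow> bobj F () \<in> BObj C"
    by (auto simp: terminal_biskew_def PiE_def extensional_def)
  have ext: "(\<forall>p q (n::nat). (p = Tight \<or> q = Tight) \<and> n = 0 \<longrightarrow>
        bhom F p q (replicate n ()) () = (\<lambda>_. undefined)) \<longleftrightarrow>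
      (\<forall>p q. p = Tight \<or> q = Tight \<longrightarrow> bhom F p q [] () = (\<lambda>_. undefined))"
    by auto
  have id: "(\<forall>u\<in>BObj terminal_biskew. bhom F Tight Tight [u] u (BId terminal_biskew u) = BId C (bobj F u))
      \<longleftrightarrow> bhom F Tight Tight (replicate 1 ()) () () = BId C (bobj F ())"
    by (simp add: terminal_biskew_def)
  show ?thesis
    unfolding is_biskew_map_def unbiased_def unit_list unit_all map_obj app at_input_replicate
      hom inhabited obj id comp_pow_def ext[symmetric]
    by (simp (no_asm_simp) only: all_conj_distrib simp_thms zero_less_Suc) (auto simp del: replicate.simps)
qed

section \<open>Simultaneous composition and homomorphisms\<close>

context
  fixes a b f
  assumes f: "f \<in> BHom C Tight Tight [a] b"
begin

text \<open>Unlike \<open>BComps\<close>, this leaves inputs \<open>post\<close> unplugged; without them, a simultaneous composite into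
  \<open>h \<circ> g\<close> could not be split off as one into \<open>g\<close>.\<close>

primrec plug :: "tightness \<Rightarrow> tightness \<Rightarrow> 'o list \<Rightarrow> nat \<Rightarrow> 'o list \<Rightarrow> 'o \<Rightarrow> 'm \<Rightarrow> 'm" where
  "plug p q pre 0 post z g = g"
| "plug p q pre (Suc n) post z g =
     plug p q (pre @ [a]) n post z (BComp C p q pre [a] (replicate n b @ post) b z g
       (BLoosen_to C (at_input p pre) (at_input q (replicate n b @ post)) [a] b f))"

lemma BComps_replicate:
  "BComps C p q pre (replicate n (a, b, f)) z g = plug p q pre n [] z g"
  by (induction n arbitrary: pre g) simp_all

text \<open>\<open>plug\<close> fills the leftmost input first, whereas the recursion for products
  splits off the last factor; the filling therefore has to be unwound from the right.\<close>

lemma plug_snoc: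
  "plug p q pre (Suc n) post z g =
     BComp C p q (pre @ replicate n a) [a] post b z (plug p q pre n (b # post) z g)
       (BLoosen_to C (at_input p (pre @ replicate n a)) (at_input q post) [a] b f)"
proof (induction n arbitrary: pre g)
  case (Suc n)
  show ?case
    by (subst plug.simps(2), subst Suc.IH) (simp add: replicate_app_Cons_same)
qed simp

text \<open>Since \<open>g\<close> sits at the first input of \<open>h\<close>, every filled input
  of the composite is an input of \<open>g\<close>, and associativity moves the filling
  inside.\<close>

lemma plug_comp:
  assumes "h \<in> BHom C p q (y # post) z" "g \<in> BHom C p (at_input q post) (pre @ replicate n b) y"
  shows "plug p q pre n post z (BComp C p q [] (pre @ replicate n b) post y z h g)
       = BComp C p q [] (pre @ replicate n a) post y z h (plug p (at_input q post) pre n [] y g)"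
  using assms(2)
proof (induction n arbitrary: pre g)
  case (Suc n)
  let ?f = "BLoosen_to C (at_input p pre) (at_pos (at_input q post) n) [a] b f"
  have "BComp C p (at_input q post) pre [a] (replicate n b) b y g ?f
      \<in> BHom C p (at_input q post) ((pre @ [a]) @ replicate n b) y"
    using comp_hom[of g p "at_input q post" pre b "replicate n b" y ?f "[a]"] Suc.prems
      BLoosen_to_hom[OF f] by simp
  from Suc.IH[OF this] show ?case
    using assoc[of h p q "[]" y post z g pre b "replicate n b" ?f "[a]"] Suc.prems assms(1)
      BLoosen_to_hom[OF f] by simp
qed simp

end

text \<open>The right-hand side is \<open>BComps\<close> for two morphisms written out. Loosening
  passes through it in two stages, one for each copy of \<open>f\<close>, and through the left-hand
  side in one.\<close>

lemma biskew_monoid_hom_loosen: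
  assumes "f \<in> BHom C Tight Tight [x] y" "m \<in> BHom C Tight Tight [x, x] x"
    "n \<in> BHom C Tight Tight [y, y] y"
    and "BComp C Tight Tight [] [x, x] [] x y f m = BComps C Tight Tight [] [(x, y, f), (x, y, f)] y n"
  shows "BComp C p q [] [x, x] [] x y (BLoosen_to C p q [x] y f) (BLoosen_to C p q [x, x] x m)
       = BComp C p q [x] [x] [] y y
           (BComp C p q [] [x] [y] y y (BLoosen_to C p q [y, y] y n) (BLoosen_to C p Loose [x] y f))
           (BLoosen_to C Loose q [x] y f)"
proof -
  let ?nf = "BComp C Tight Tight [] [x] [y] y y n (BLoosen_to C Tight Loose [x] y f)"
  have "?nf \<in> BHom C Tight Tight [x, y] y"
    using comp_hom[of n Tight Tight "[]" y "[y]" y "BLoosen_to C Tight Loose [x] y f" "[x]"]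
      assms(3) BLoosen_to_hom[OF assms(1)] by simp
  then show ?thesis
    using BLoosen_to_comp[of f "[]" x "[]" y m "[x, x]" p q]
      BLoosen_to_comp[of n "[]" y "[y]" y f "[x]" p q]
      BLoosen_to_comp[of ?nf "[x]" y "[]" y f "[x]" p q] assms by simp
qed

text \<open>Arity 0 is the unit condition and arity 1 follows from the identity laws. A larger
  product is \<open>m_2\<close> with a smaller product at its first input: the induction hypothesis
  treats the smaller product, the binary condition treats \<open>m_2\<close>. The tightnesses vary
  because the smaller product is loose on the right.\<close>

lemma unbiased_monoid_hom:
  assumes M: "unbiased x M" and N: "unbiased y N"
    and f: "is_biskew_monoid_hom C (x, M Tight Tight 2, M Loose Loose 0)
      (y, N Tight Tight 2, N Loose Loose 0) f"
    and "n > 0 \<or> p = Loose \<and> q = Loose"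
  shows "BComp C p q [] (replicate n x) [] x y (BLoosen_to C p q [x] y f) (M p q n)
       = BComps C p q [] (replicate n (x, y, f)) y (N p q n)"
  using assms(4)
proof (induction n arbitrary: p q rule: induct_nat_012)
  case 0
  then show ?case using f by (simp add: is_biskew_monoid_hom_def)
next
  case 1
  have fh: "BLoosen_to C p q [x] y f \<in> BHom C p q [x] y"
    using f by (auto simp: is_biskew_monoid_hom_def intro: BLoosen_to_hom)
  then show ?case
    using unbiased_loosen[OF M, of 1 p q] unbiased_loosen[OF N, of 1 p q] unbiased_id[OF M]
      unbiased_id[OF N] comp_id[of _ p q "[]" x "[]" y] id_comp[of _ p q "[x]" y] by simp
next
  case (ge2 k)
  define n where "n = Suc k"
  have f': "f \<in> BHom C Tight Tight [x] y"
    and fm: "BComp C Tight Tight [] [x, x] [] x y f (M Tight Tight 2)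
       = BComps C Tight Tight [] [(x, y, f), (x, y, f)] y (N Tight Tight 2)"
    using f by (auto simp: is_biskew_monoid_hom_def)
  note fh = BLoosen_to_hom[OF f']
  have hom2: "M r s 2 \<in> BHom C r s [x, x] x" "N r s 2 \<in> BHom C r s [y, y] y" for r s
    using unbiased_hom[OF M, of 2 r s] unbiased_hom[OF N, of 2 r s]
    by (simp_all add: hom_pow_def numeral_2_eq_2)
  have homn: "M p Loose n \<in> BHom C p Loose (replicate n x) x"
    "N p Loose n \<in> BHom C p Loose (replicate n y) y"
    using unbiased_hom[OF M, of n p Loose] unbiased_hom[OF N, of n p Loose]
    by (simp_all add: hom_pow_def n_def)
  have Suc: "M p q (Suc n) = BComp C p q [] (replicate n x) [x] x x (M p q 2) (M p Loose n)"
    "N p q (Suc n) = BComp C p q [] (replicate n y) [y] y y (N p q 2) (N p Loose n)"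
    using unbiased_Suc[OF M, of n p q] unbiased_Suc[OF N, of n p q]
    by (simp_all add: n_def comp_pow_def)
  let ?f = "\<lambda>p q. BLoosen_to C p q [x] y f"
  let ?Nf = "BComp C p q [] [x] [y] y y (N p q 2) (?f p Loose)"
  have Nf: "?Nf \<in> BHom C p q [x, y] y"
    using comp_hom[of "N p q 2" p q "[]" y "[y]" y "?f p Loose" "[x]"] hom2 fh by simp
  have f2: "BComp C p q [] [x, x] [] x y (?f p q) (M p q 2)
      = BComp C p q [x] [x] [] y y ?Nf (?f Loose q)"
    using biskew_monoid_hom_loosen[OF f' hom2(1) hom2(2) fm, of p q]
      unbiased_loosen[OF M, of 2 p q] unbiased_loosen[OF N, of 2 p q]
    by (simp add: numeral_2_eq_2)
  have "BComps C p q [] (replicate (Suc n) (x, y, f)) y (N p q (Suc n))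
      = plug x y f p q [] (Suc n) [] y (N p q (Suc n))"
    by (rule BComps_replicate[OF f'])
  also have "\<dots> = BComp C p q (replicate n x) [x] [] y y
      (plug x y f p q [] n [y] y (N p q (Suc n))) (?f Loose q)"
    using plug_snoc[OF f', of p q "[]" n "[]"] by (simp add: n_def del: plug.simps)
  also have "plug x y f p q [] n [y] y (N p q (Suc n))
      = BComp C p q [] (replicate n x) [y] y y (N p q 2) (plug x y f p Loose [] n [] y (N p Loose n))"
    using plug_comp[OF f', of "N p q 2" p q y "[y]" y "N p Loose n" "[]" n] hom2 homn
    by (simp add: Suc)
  also have "plug x y f p Loose [] n [] y (N p Loose n)
      = BComp C p Loose [] (replicate n x) [] x y (?f p Loose) (M p Loose n)"
    using ge2.IH(2)[of p Loose] BComps_replicate[OF f', of p Loose "[]" n] by (simp add: n_def)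
  also have "BComp C p q [] (replicate n x) [y] y y (N p q 2) \<dots>
      = BComp C p q [] (replicate n x) [y] x y ?Nf (M p Loose n)"
    using assoc[of "N p q 2" p q "[]" y "[y]" y "?f p Loose" "[]" x "[]"] hom2 homn fh by simp
  \<comment> \<open>Interchange brings both copies of \<open>f\<close> together on the binary
    product, ready for \<open>f2\<close>.\<close>
  also have "BComp C p q (replicate n x) [x] [] y y \<dots> (?f Loose q)
      = BComp C p q [] (replicate n x) [x] x y (BComp C p q [x] [x] [] y y ?Nf (?f Loose q))
          (M p Loose n)"
    using interchange[of ?Nf p q "[]" x "[]" y "[]" y "M p Loose n" "replicate n x" "?f Loose q" "[x]"]
      Nf homn fh by simp
  also have "\<dots> = BComp C p q [] (replicate (Suc n) x) [] x y (?f p q) (M p q (Suc n))"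
    unfolding f2[symmetric] Suc
    using assoc[of "?f p q" p q "[]" x "[]" y "M p q 2" "[]" x "[x]" "M p Loose n" "replicate n x"]
      fh hom2 homn by (simp add: replicate_append_same)
  finally show ?case by (simp add: n_def)
qed

text \<open>Naturality at the nullary loose-loose and the binary tight-tight morphism gives the
  homomorphism conditions; conversely, all instances of naturality come from
  \<open>unbiased_monoid_hom\<close>.\<close>

lemma is_biskew_cell_terminal_iff:
  assumes "is_biskew_map terminal_biskew C F" "is_biskew_map terminal_biskew C G"
  shows "is_biskew_cell terminal_biskew C F G \<alpha> \<longleftrightarrow>
    is_biskew_monoid_hom C (biskew_biased_counterpart F) (biskew_biased_counterpart G) (\<alpha> ())"
    (is "?cell \<longleftrightarrow> ?hom")
proof
  assume cell: ?cell
  have eq: "BComp C p q [] (map (bobj F) as) [] (bobj F ()) (bobj G ())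
          (BLoosen_to C p q [bobj F ()] (bobj G ()) (\<alpha> ())) (bhom F p q as () ())
        = BComps C p q [] (map (\<lambda>a. (bobj F a, bobj G a, \<alpha> a)) as) (bobj G ())
            (bhom G p q as () ())" if "\<not> ((p = Tight \<or> q = Tight) \<and> as = [])" for p q as
    using cell that by (simp add: is_biskew_cell_def terminal_biskew_def)
  show ?hom
    using eq[of Tight Tight "[(), ()]"] eq[of Loose Loose "[]"] cell
    by (simp add: is_biskew_monoid_hom_def biskew_biased_counterpart_def is_biskew_cell_def
        terminal_biskew_def)
next
  assume hom: ?hom
  have "BComp C p q [] (map (bobj F) as) [] (bobj F ()) (bobj G ())
          (BLoosen_to C p q [bobj F ()] (bobj G ()) (\<alpha> ())) (bhom F p q as () ())
        = BComps C p q [] (map (\<lambda>a. (bobj F a, bobj G a, \<alpha> a)) as) (bobj G ())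
            (bhom G p q as () ())" if "\<not> ((p = Tight \<or> q = Tight) \<and> as = [])" for p q as
  proof -
    obtain n where n: "as = replicate n ()" by (rule unit_listE)
    have "n > 0 \<or> p = Loose \<and> q = Loose" using that n by (cases p; cases q) auto
    from unbiased_monoid_hom[OF _ _ _ this,
        of "bobj F ()" "\<lambda>p q n. bhom F p q (replicate n ()) () ()"
           "bobj G ()" "\<lambda>p q n. bhom G p q (replicate n ()) () ()" "\<alpha> ()"]
    show ?thesis
      using hom assms
      by (simp add: n is_biskew_map_terminal_iff biskew_biased_counterpart_def numeral_2_eq_2)
  qed
  then show ?cell
    using hom by (simp add: is_biskew_cell_def terminal_biskew_def is_biskew_monoid_hom_def
        biskew_biased_counterpart_def extensional_def)
qed

end

lemma (in biskew_monoid) unbiased_mult: "unbiased x mult"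
  using x_obj mult_hom mult_loosenL mult_loosenR mult_comp
  by (simp add: unbiased_def iota_def)

section \<open>Isomorphisms of categories given by components\<close>

text \<open>Functions on \<open>unit\<close> are determined by their value, so an isomorphism acting
  on arrows by \<open>the_component\<close> amounts to a bijection on objects under which the
  hom-sets of \<open>A\<close> are those of \<open>B\<close> read through evaluation at
  \<open>()\<close>.\<close>

definition component_isomorphism ::
  "('a, unit \<Rightarrow> 'm) cat \<Rightarrow> ('b, 'm) cat \<Rightarrow> ('a \<Rightarrow> 'b) \<Rightarrow> bool" where
  "component_isomorphism A B Fo \<longleftrightarrow> category B \<and> bij_betw Fo (Ob A) (Ob B) \<and>
     (\<forall>a\<in>Ob A. \<forall>b\<in>Ob A. Arr A a b = {\<alpha>. \<alpha> () \<in> Arr B (Fo a) (Fo b)}) \<and>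
     (\<forall>a\<in>Ob A. Ident A a () = Ident B (Fo a)) \<and>
     (\<forall>a\<in>Ob A. \<forall>b\<in>Ob A. \<forall>c\<in>Ob A. \<forall>\<alpha>\<in>Arr A a b. \<forall>\<beta>\<in>Arr A b c.
        Compose A a b c \<beta> \<alpha> () = Compose B (Fo a) (Fo b) (Fo c) (\<beta> ()) (\<alpha> ()))"

text \<open>Evaluation at \<open>()\<close> is injective, so the category laws of \<open>A\<close>
  are inherited from \<open>B\<close>; the inverse sends an arrow to the constant function with that
  value.\<close>

lemma component_isomorphism_imp_isomorphism:
  fixes A :: "('a, unit \<Rightarrow> 'm) cat"
  assumes "component_isomorphism A B Fo"
  shows "isomorphism_of_categories A B Fo the_component"
proof -
  define Go where "Go = inv_into (Ob A) Fo"
  have B: "category B" and bij: "bij_betw Fo (Ob A) (Ob B)"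
    and arr: "\<And>a b. \<lbrakk>a \<in> Ob A; b \<in> Ob A\<rbrakk> \<Longrightarrow> Arr A a b = {\<alpha>. \<alpha> () \<in> Arr B (Fo a) (Fo b)}"
    and ident: "\<And>a. a \<in> Ob A \<Longrightarrow> Ident A a () = Ident B (Fo a)"
    and comp: "\<And>a b c \<alpha> \<beta>. \<lbrakk>a \<in> Ob A; b \<in> Ob A; c \<in> Ob A; \<alpha> () \<in> Arr B (Fo a) (Fo b);
        \<beta> () \<in> Arr B (Fo b) (Fo c)\<rbrakk> \<Longrightarrow>
        Compose A a b c \<beta> \<alpha> () = Compose B (Fo a) (Fo b) (Fo c) (\<beta> ()) (\<alpha> ())"
    using assms by (simp_all add: component_isomorphism_def)
  have Fo: "a \<in> Ob A \<Longrightarrow> Fo a \<in> Ob B" and Go: "b \<in> Ob B \<Longrightarrow> Go b \<in> Ob A"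
    and GF: "a \<in> Ob A \<Longrightarrow> Go (Fo a) = a" and FG: "b \<in> Ob B \<Longrightarrow> Fo (Go b) = b" for a b
    using bij unfolding Go_def
    by (auto simp: bij_betw_def bij_betw_inv_into_left f_inv_into_f inv_into_into)
  have Bi: "a \<in> Ob B \<Longrightarrow> Ident B a \<in> Arr B a a"
    and Bc: "\<lbrakk>a \<in> Ob B; b \<in> Ob B; c \<in> Ob B; f \<in> Arr B a b; g \<in> Arr B b c\<rbrakk>
      \<Longrightarrow> Compose B a b c g f \<in> Arr B a c"
    and Bi1: "\<lbrakk>a \<in> Ob B; b \<in> Ob B; f \<in> Arr B a b\<rbrakk> \<Longrightarrow> Compose B a a b f (Ident B a) = f"
    and Bi2: "\<lbrakk>a \<in> Ob B; b \<in> Ob B; f \<in> Arr B a b\<rbrakk> \<Longrightarrow> Compose B a b b (Ident B b) f = f"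
    and Ba: "\<lbrakk>a \<in> Ob B; b \<in> Ob B; c \<in> Ob B; d \<in> Ob B; f \<in> Arr B a b; g \<in> Arr B b c; h \<in> Arr B c d\<rbrakk>
      \<Longrightarrow> Compose B a b d (Compose B b c d h g) f = Compose B a c d h (Compose B a b c g f)"
    for a b c d f g h
    using B unfolding category_def by blast+
  have unit_fun_eq: "\<alpha> = \<beta> \<longleftrightarrow> \<alpha> () = \<beta> ()" for \<alpha> \<beta> :: "unit \<Rightarrow> 'm"
    by (auto simp: fun_eq_iff)
  have A: "category A"
    unfolding category_def by (simp add: arr ident comp Fo Bi Bc unit_fun_eq Bi1 Bi2 Ba)
  have F: "is_functor A B Fo the_component"
    unfolding is_functor_def by (simp add: A B Fo arr ident comp the_component_def)
  have G: "is_functor B A Go (\<lambda>b c g _. g)"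
    unfolding is_functor_def by (simp add: A B Go FG arr ident comp unit_fun_eq)
  show ?thesis
    unfolding isomorphism_of_categories_def
    by (intro conjI F exI[of _ Go] exI[of _ "\<lambda>b c g _. g"] G)
      (auto simp: GF FG the_component_def)
qed

text \<open>Objects are reindexed along \<open>\<phi>\<close> while arrows, identities and
  composition stay literally the same. This carries coherence from bi-skew to left-skew and on to
  ordinary multicategories.\<close>

lemma component_isomorphism_transfer:
  assumes "component_isomorphism A B Fo" "bij_betw \<phi> (Ob A') (Ob A)"
    and "\<And>a b. \<lbrakk>a \<in> Ob A'; b \<in> Ob A'\<rbrakk> \<Longrightarrow> Arr A' a b = Arr A (\<phi> a) (\<phi> b)"
    and "\<And>a. Ident A' a = Ident A (\<phi> a)"
    and "\<And>a b c. Compose A' a b c = Compose A (\<phi> a) (\<phi> b) (\<phi> c)"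
    and "\<And>a. Fo' a = Fo (\<phi> a)"
  shows "component_isomorphism A' B Fo'"
proof -
  have "\<phi> a \<in> Ob A" if "a \<in> Ob A'" for a using assms(2) that by (auto simp: bij_betw_def)
  moreover have "bij_betw Fo' (Ob A') (Ob B)"
    using bij_betw_trans[OF assms(2), of Fo "Ob B"] assms(1,6)
    by (simp add: component_isomorphism_def comp_def cong: bij_betw_cong)
  ultimately show ?thesis
    using assms(1) by (simp add: component_isomorphism_def assms(3-6))
qed

section \<open>Coherence for bi-skew multicategories\<close>

context biskew_multicategory
begin

lemma biskew_monoid_hom_id:
  assumes "is_biskew_monoid C (x, m, e)"
  shows "is_biskew_monoid_hom C (x, m, e) (x, m, e) (BId C x)"
  using assms id_hom[of x] comp_id[of m Tight Tight "[]" x "[x]" x]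
    comp_id[of m Tight Tight "[x]" x "[]" x] id_comp[of m Tight Tight "[x, x]" x]
    id_comp[of e Loose Loose "[]" x]
  by (simp add: is_biskew_monoid_def is_biskew_monoid_hom_def)

text \<open>The computation is
  \<open>g (f m) = g (n (f, f)) = (k (g, g)) (f, f) = k (g f, g f)\<close>, where
  \<open>gf_loosen\<close> identifies the loosened composite with the composite of loosened
  morphisms.\<close>

lemma biskew_monoid_hom_comp:
  assumes M: "is_biskew_monoid C (x, m, e)" and N: "is_biskew_monoid C (y, n, u)"
    and K: "is_biskew_monoid C (z, k, v)"
    and f: "is_biskew_monoid_hom C (x, m, e) (y, n, u) f"
    and g: "is_biskew_monoid_hom C (y, n, u) (z, k, v) g"
  shows "is_biskew_monoid_hom C (x, m, e) (z, k, v) (BComp C Tight Tight [] [x] [] y z g f)"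
proof -
  let ?gf = "BComp C Tight Tight [] [x] [] y z g f"
  let ?L = "BLoosen_to C Loose Tight" and ?R = "BLoosen_to C Tight Loose"
  have m: "m \<in> BHom C Tight Tight [x, x] x" and e: "e \<in> BHom C Loose Loose [] x"
    and n: "n \<in> BHom C Tight Tight [y, y] y" and k: "k \<in> BHom C Tight Tight [z, z] z"
    using M N K by (simp_all add: is_biskew_monoid_def)
  have fh: "f \<in> BHom C Tight Tight [x] y" and gh: "g \<in> BHom C Tight Tight [y] z"
    and fe: "BComp C Loose Loose [] [] [] x y (BLoosen_to C Loose Loose [x] y f) e = u"
    and ge: "BComp C Loose Loose [] [] [] y z (BLoosen_to C Loose Loose [y] z g) u = v"
    and fm: "BComp C Tight Tight [] [x, x] [] x y f m
      = BComp C Tight Tight [x] [x] [] y y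
          (BComp C Tight Tight [] [x] [y] y y n (?R [x] y f)) (?L [x] y f)"
    and gn: "BComp C Tight Tight [] [y, y] [] y z g n
      = BComp C Tight Tight [y] [y] [] z z
          (BComp C Tight Tight [] [y] [z] z z k (?R [y] z g)) (?L [y] z g)"
    using f g by (simp_all add: is_biskew_monoid_hom_def)
  note fl = BLoosen_to_hom[OF fh] and gl = BLoosen_to_hom[OF gh]
  have gfh: "?gf \<in> BHom C Tight Tight [x] z"
    using comp_hom[of g Tight Tight "[]" y "[]" z f "[x]"] fh gh by simp
  have gf_loosen: "BLoosen_to C p q [x] z ?gf
      = BComp C p q [] [x] [] y z (BLoosen_to C p q [y] z g) (BLoosen_to C p q [x] y f)" for p q
    using BLoosen_to_comp[of g "[]" y "[]" z f "[x]" p q] fh gh by simp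
  let ?nf = "BComp C Tight Tight [] [x] [y] y y n (?R [x] y f)"
  let ?kg = "BComp C Tight Tight [] [y] [z] z z k (?R [y] z g)"
  have nf: "?nf \<in> BHom C Tight Tight [x, y] y"
    using comp_hom[of n Tight Tight "[]" y "[y]" y "?R [x] y f" "[x]"] n fl by simp
  have kg: "?kg \<in> BHom C Tight Tight [y, z] z"
    using comp_hom[of k Tight Tight "[]" z "[z]" z "?R [y] z g" "[y]"] k gl by simp
  have kgf: "BComp C Tight Tight [] [x] [z] y z ?kg (?R [x] y f) \<in> BHom C Tight Tight [x, z] z"
    using comp_hom[of ?kg Tight Tight "[]" y "[z]" z "?R [x] y f" "[x]"] kg fl by simp
  have "BComp C Tight Tight [] [x, x] [] x z ?gf m
      = BComp C Tight Tight [] [x, x] [] y z g (BComp C Tight Tight [] [x, x] [] x y f m)"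
    using assoc[of g Tight Tight "[]" y "[]" z f "[]" x "[]" m "[x, x]"] m fh gh by simp
  also have "\<dots> = BComp C Tight Tight [x] [x] [] y z
      (BComp C Tight Tight [] [x, y] [] y z g ?nf) (?L [x] y f)"
    unfolding fm
    using assoc[of g Tight Tight "[]" y "[]" z ?nf "[x]" y "[]" "?L [x] y f" "[x]"] nf fl gh
    by simp
  also have "BComp C Tight Tight [] [x, y] [] y z g ?nf
      = BComp C Tight Tight [] [x] [y] y z (BComp C Tight Tight [] [y, y] [] y z g n) (?R [x] y f)"
    using assoc[of g Tight Tight "[]" y "[]" z n "[]" y "[y]" "?R [x] y f" "[x]"] n fl gh
    by simp
  \<comment> \<open>Interchange lets \<open>f\<close> enter the first input before \<open>g\<close>
    enters the second, so that each \<open>f\<close> can be absorbed by the \<open>g\<close> at its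
    own input.\<close>
  also have "\<dots> = BComp C Tight Tight [x] [y] [] z z
      (BComp C Tight Tight [] [x] [z] y z ?kg (?R [x] y f)) (?L [y] z g)"
    unfolding gn
    using interchange[of ?kg Tight Tight "[]" y "[]" z "[]" z "?R [x] y f" "[x]" "?L [y] z g" "[y]"]
      kg fl gl by simp
  also have "BComp C Tight Tight [x] [x] [] y z \<dots> (?L [x] y f)
      = BComp C Tight Tight [x] [x] [] z z
          (BComp C Tight Tight [] [x] [z] y z ?kg (?R [x] y f)) (?L [x] z ?gf)"
    unfolding gf_loosen
    using assoc[of "BComp C Tight Tight [] [x] [z] y z ?kg (?R [x] y f)" Tight Tight "[x]" z "[]" z
        "?L [y] z g" "[]" y "[]" "?L [x] y f" "[x]"] kgf fl gl by simp
  also have "BComp C Tight Tight [] [x] [z] y z ?kg (?R [x] y f)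
      = BComp C Tight Tight [] [x] [z] z z k (?R [x] z ?gf)"
    unfolding gf_loosen
    using assoc[of k Tight Tight "[]" z "[z]" z "?R [y] z g" "[]" y "[]" "?R [x] y f" "[x]"] k fl gl
    by simp
  finally have "BComp C Tight Tight [] [x, x] [] x z ?gf m
      = BComps C Tight Tight [] [(x, z, ?gf), (x, z, ?gf)] z k"
    by simp
  moreover have "BComp C Loose Loose [] [] [] x z (BLoosen_to C Loose Loose [x] z ?gf) e = v"
    unfolding gf_loosen ge[symmetric] fe[symmetric]
    using assoc[of "BLoosen_to C Loose Loose [y] z g" Loose Loose "[]" y "[]" z
        "BLoosen_to C Loose Loose [x] y f" "[]" x "[]" e "[]"] fl gl e by simp
  ultimately show ?thesis using gfh by (simp add: is_biskew_monoid_hom_def)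
qed

lemma category_biskew_Mon: "category (biskew_Mon C)"
proof -
  have id: "BComp C Tight Tight [] [x] [] y y (BId C y) f = f"
    "BComp C Tight Tight [] [x] [] x y f (BId C x) = f"
    if "f \<in> BHom C Tight Tight [x] y" for x y f
    using that id_comp[of f Tight Tight "[x]" y] comp_id[of f Tight Tight "[]" x "[]" y] by simp_all
  have as: "BComp C Tight Tight [] [w] [] x z (BComp C Tight Tight [] [x] [] y z h g) f
      = BComp C Tight Tight [] [w] [] y z h (BComp C Tight Tight [] [w] [] x y g f)"
    if "f \<in> BHom C Tight Tight [w] x" "g \<in> BHom C Tight Tight [x] y" "h \<in> BHom C Tight Tight [y] z"
    for w x y z f g h
    using that assoc[of h Tight Tight "[]" y "[]" z g "[]" x "[]" f "[w]"] by simp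
  show ?thesis
    unfolding category_def biskew_Mon_def
    by (auto intro: biskew_monoid_hom_id biskew_monoid_hom_comp)
      (simp_all add: is_biskew_monoid_hom_def id as)
qed

text \<open>Injectivity is \<open>unbiased_unique\<close> together with extensionality; surjectivity
  comes from the left-nested products \<open>mult\<close>.\<close>

lemma bij_betw_biskew_biased_counterpart:
  "bij_betw biskew_biased_counterpart (Ob (biskew_UnbiasMon C)) (Ob (biskew_Mon C))"
proof (rule bij_betwI')
  fix F G
  assume "F \<in> Ob (biskew_UnbiasMon C)" "G \<in> Ob (biskew_UnbiasMon C)"
  then have F: "unbiased (bobj F ()) (\<lambda>p q n. bhom F p q (replicate n ()) () ())"
      "\<And>p q. p = Tight \<or> q = Tight \<Longrightarrow> bhom F p q [] () = (\<lambda>_. undefined)"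
    and G: "unbiased (bobj G ()) (\<lambda>p q n. bhom G p q (replicate n ()) () ())"
      "\<And>p q. p = Tight \<or> q = Tight \<Longrightarrow> bhom G p q [] () = (\<lambda>_. undefined)"
    by (auto simp: biskew_UnbiasMon_def biskew_hom_category_def is_biskew_map_terminal_iff)
  show "biskew_biased_counterpart F = biskew_biased_counterpart G \<longleftrightarrow> F = G"
  proof
    assume eq: "biskew_biased_counterpart F = biskew_biased_counterpart G"
    then have x: "bobj F = bobj G" by (auto simp: biskew_biased_counterpart_def fun_eq_iff)
    have "bhom F p q as w t = bhom G p q as w t" for p q as w t
    proof -
      obtain n where n: "as = replicate n ()" by (rule unit_listE)
      show ?thesis
      proof (cases "n > 0 \<or> p = Loose \<and> q = Loose")
        case True
        then show ?thesis
          using unbiased_unique[OF F(1) G(1)[folded x] _ _ True] eq n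
          by (simp add: biskew_biased_counterpart_def numeral_2_eq_2)
      next
        case False
        then have "p = Tight \<or> q = Tight" "as = []" using n by (cases p; cases q; simp)+
        then show ?thesis using F(2) G(2) by simp
      qed
    qed
    then show "F = G" using x by (cases F; cases G) (auto simp: fun_eq_iff)
  qed simp
next
  fix F
  assume "F \<in> Ob (biskew_UnbiasMon C)"
  then show "biskew_biased_counterpart F \<in> Ob (biskew_Mon C)"
    using unbiased_imp_monoid[of "bobj F ()" "\<lambda>p q n. bhom F p q (replicate n ()) () ()"]
    by (simp add: biskew_UnbiasMon_def biskew_hom_category_def biskew_Mon_def
        is_biskew_map_terminal_iff biskew_biased_counterpart_def numeral_2_eq_2)
next
  fix M
  assume "M \<in> Ob (biskew_Mon C)"
  then obtain x m e where M: "M = (x, m, e)" "is_biskew_monoid C (x, m, e)"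
    by (cases M) (auto simp: biskew_Mon_def)
  then interpret biskew_monoid C x m e by unfold_locales
  \<comment> \<open>Over the empty hom-sets a map has to be \<open>undefined\<close>, whereas
    \<open>mult\<close> has the default value \<open>e\<close> there.\<close>
  define F :: "(unit, unit, 'o, 'm) biskew_map" where
    "F = \<lparr>bobj = (\<lambda>_. x), bhom = (\<lambda>p q as _. if (p = Tight \<or> q = Tight) \<and> as = []
            then (\<lambda>_. undefined) else (\<lambda>_. mult p q (length as)))\<rparr>"
  have "unbiased x (\<lambda>p q n. bhom F p q (replicate n ()) () ())"
    using unbiased_mult
    by (auto simp: unbiased_def F_def)
  then have "F \<in> Ob (biskew_UnbiasMon C)"
    by (simp add: biskew_UnbiasMon_def biskew_hom_category_def is_biskew_map_terminal_iff F_def)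
  moreover have "biskew_biased_counterpart F = M"
    using mult_2[of Tight Tight]
    by (simp add: M F_def biskew_biased_counterpart_def numeral_2_eq_2 mu_def)
  ultimately show "\<exists>F\<in>Ob (biskew_UnbiasMon C). M = biskew_biased_counterpart F" by blast
qed

lemma BObj_terminal_biskew: "BObj terminal_biskew = UNIV"
  by (simp add: terminal_biskew_def)

lemma biskew_coherence:
  "component_isomorphism (biskew_UnbiasMon C) (biskew_Mon C) biskew_biased_counterpart"
  unfolding component_isomorphism_def
  using category_biskew_Mon bij_betw_biskew_biased_counterpart
  by (auto simp: biskew_UnbiasMon_def biskew_hom_category_def biskew_Mon_def
      is_biskew_cell_terminal_iff biskew_biased_counterpart_def BObj_terminal_biskew)

end

section \<open>Left-skew multicategories as bi-skew multicategories\<close>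

text \<open>Right tightness only records that the source is nonempty, so right loosening is an
  inclusion of hom-sets.\<close>

definition biskew_of_left_skew :: "('o, 'm) skew_multicat \<Rightarrow> ('o, 'm) biskew_multicat" where
  "biskew_of_left_skew C = \<lparr>
     BObj = SObj C,
     BHom = (\<lambda>p q as x. if q = Tight \<and> as = [] then {} else SHom C p as x),
     BLoosenL = (\<lambda>q. SLoosen C),
     BLoosenR = (\<lambda>p as x f. f),
     BId = SId C,
     BComp = (\<lambda>p q. SComp C p) \<rparr>"

lemma biskew_of_left_skew_simps [simp]:
  "BObj (biskew_of_left_skew C) = SObj C"
  "BHom (biskew_of_left_skew C) p q as x = (if q = Tight \<and> as = [] then {} else SHom C p as x)"
  "BLoosenL (biskew_of_left_skew C) q = SLoosen C"
  "BLoosenR (biskew_of_left_skew C) p as x f = f"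
  "BId (biskew_of_left_skew C) = SId C"
  "BComp (biskew_of_left_skew C) p q = SComp C p"
  by (simp_all add: biskew_of_left_skew_def)

lemma BLoosen_to_biskew_of_left_skew [simp]:
  "BLoosen_to (biskew_of_left_skew C) p q as x f = SLoosen_to C p as x f"
  by (cases p; cases q) (simp_all add: BLoosen_to_def SLoosen_to_def)

lemma BComps_biskew_of_left_skew [simp]:
  "BComps (biskew_of_left_skew C) p q pre ts y g = SComps C p pre ts y g"
  by (induction ts arbitrary: pre g) (simp_all split: prod.split)

lemma biskew_multicategory_of_left_skew:
  assumes "left_skew_multicategory C"
  shows "biskew_multicategory (biskew_of_left_skew C)"
proof -
  interpret left_skew_multicategory C by fact
  show ?thesis
    by unfold_locales
      (auto simp: hom_obj loosen_hom id_hom comp_hom loosen_comp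
        loosen_comp[where as = "[]", simplified] assoc interchange comp_id id_comp
        dest: tight_nonempty hom_obj split: if_splits)
qed

text \<open>Right loosening is the identity function, so the axioms and the homomorphism conditions
  reduce to the left-skew ones and the two categories are equal, not merely isomorphic.\<close>

lemma biskew_Mon_of_left_skew: "biskew_Mon (biskew_of_left_skew C) = left_skew_Mon C"
  by (simp add: biskew_Mon_def left_skew_Mon_def is_biskew_monoid_def is_left_skew_monoid_def
      is_biskew_monoid_hom_def is_left_skew_monoid_hom_def SLoosen_to_def)

text \<open>The exclusion of empty sources from right-tight hom-sets makes this an equality, so that
  maps out of the two terminal objects can be compared directly.\<close>

lemma terminal_biskew_of_left_skew: "terminal_biskew = biskew_of_left_skew terminal_left_skew"
  by (auto simp: terminal_biskew_def biskew_of_left_skew_def terminal_left_skew_def fun_eq_iff)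

text \<open>The default \<open>undefined\<close> keeps the map extensional over the empty
  right-tight hom-sets.\<close>

definition biskew_map_of_left_skew ::
  "('o, 'm, 'p, 'n) skew_map \<Rightarrow> ('o, 'm, 'p, 'n) biskew_map" where
  "biskew_map_of_left_skew F = \<lparr>
     bobj = sobj F,
     bhom = (\<lambda>p q as x. if q = Tight \<and> as = [] then (\<lambda>_. undefined) else shom F p as x) \<rparr>"

lemma bobj_biskew_map_of_left_skew [simp]: "bobj (biskew_map_of_left_skew F) = sobj F"
  by (simp add: biskew_map_of_left_skew_def)

text \<open>All of the left-skew structure appears at right tightness \<open>Loose\<close>;
  conversely, the right-tight conditions are the loose ones restricted to nonempty sources.\<close>

lemma is_biskew_map_of_left_skew:
  "is_biskew_map (biskew_of_left_skew C) (biskew_of_left_skew D) (biskew_map_of_left_skew F)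
    \<longleftrightarrow> is_left_skew_map C D F" (is "?B \<longleftrightarrow> ?L")
proof
  assume B: ?B
  have hom: "shom F p as x \<in> SHom C p as x \<rightarrow>\<^sub>E SHom D p (map (sobj F) as) (sobj F x)" for p as x
  proof -
    let ?F = "biskew_map_of_left_skew F"
    have "bhom ?F p Loose as x \<in> BHom (biskew_of_left_skew C) p Loose as x
      \<rightarrow>\<^sub>E BHom (biskew_of_left_skew D) p Loose (map (bobj ?F) as) (bobj ?F x)"
      using B by (simp only: is_biskew_map_def)
    then show ?thesis by (simp add: biskew_map_of_left_skew_def)
  qed
  have comp: "shom F p (as @ bs @ cs) y (SComp C p as bs cs x y g f)
        = SComp D p (map (sobj F) as) (map (sobj F) bs) (map (sobj F) cs) (sobj F x) (sobj F y)
            (shom F p (as @ x # cs) y g) (shom F (at_input p as) bs x f)"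
    if "g \<in> SHom C p (as @ x # cs) y" "f \<in> SHom C (at_input p as) bs x" for p as bs cs x y g f
  proof -
    let ?F = "biskew_map_of_left_skew F"
    have "\<forall>g\<in>BHom (biskew_of_left_skew C) p Loose (as @ x # cs) y.
        \<forall>f\<in>BHom (biskew_of_left_skew C) (at_input p as) (at_input Loose cs) bs x.
        bhom ?F p Loose (as @ bs @ cs) y (BComp (biskew_of_left_skew C) p Loose as bs cs x y g f)
        = BComp (biskew_of_left_skew D) p Loose (map (bobj ?F) as) (map (bobj ?F) bs)
            (map (bobj ?F) cs) (bobj ?F x) (bobj ?F y)
            (bhom ?F p Loose (as @ x # cs) y g)
            (bhom ?F (at_input p as) (at_input Loose cs) bs x f)"
      using B unfolding is_biskew_map_def by blast
    then show ?thesis using that by (simp add: biskew_map_of_left_skew_def)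
  qed
  have "sobj F \<in> SObj C \<rightarrow>\<^sub>E SObj D"
    "\<forall>x\<in>SObj C. shom F Tight [x] x (SId C x) = SId D (sobj F x)"
    using B by (simp_all add: is_biskew_map_def biskew_map_of_left_skew_def)
  moreover have "\<forall>as x. \<forall>f\<in>SHom C Tight as x.
        shom F Loose as x (SLoosen C as x f)
        = SLoosen D (map (sobj F) as) (sobj F x) (shom F Tight as x f)"
  proof -
    let ?F = "biskew_map_of_left_skew F"
    have "\<forall>as x. \<forall>f\<in>BHom (biskew_of_left_skew C) Tight Loose as x.
        bhom ?F Loose Loose as x (BLoosenL (biskew_of_left_skew C) Loose as x f)
        = BLoosenL (biskew_of_left_skew D) Loose (map (bobj ?F) as) (bobj ?F x)
            (bhom ?F Tight Loose as x f)"
      using B unfolding is_biskew_map_def by blast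
    then show ?thesis by (simp add: biskew_map_of_left_skew_def)
  qed
  ultimately show ?L using hom comp unfolding is_left_skew_map_def by blast
next
  assume L: ?L
  have [simp]: "bobj (biskew_map_of_left_skew F) = sobj F"
    "bhom (biskew_map_of_left_skew F) p q as x =
       (if q = Tight \<and> as = [] then (\<lambda>_. undefined) else shom F p as x)" for p q as x
    by (simp_all add: biskew_map_of_left_skew_def)
  show ?B
    using L by (auto simp: is_biskew_map_def is_left_skew_map_def split: if_splits)
qed

text \<open>Naturality at right tightness \<open>Tight\<close> is naturality at \<open>Loose\<close>
  restricted to nonempty sources, so the quantifier over \<open>q\<close> collapses.\<close>

lemma is_biskew_cell_of_left_skew:
  "is_biskew_cell (biskew_of_left_skew C) (biskew_of_left_skew D)
      (biskew_map_of_left_skew F) (biskew_map_of_left_skew G) \<alpha>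
    \<longleftrightarrow> is_left_skew_cell C D F G \<alpha>" (is "?B \<longleftrightarrow> ?L")
proof -
  have "(\<forall>p q as b. \<forall>f\<in>BHom (biskew_of_left_skew C) p q as b. P p as b f) \<longleftrightarrow>
      (\<forall>p as b. \<forall>f\<in>SHom C p as b. P p as b f)" (is "?l \<longleftrightarrow> ?r") for P
  proof
    assume ?l
    then have "\<forall>f\<in>BHom (biskew_of_left_skew C) p Loose as b. P p as b f" for p as b by blast
    then show ?r by simp
  qed simp
  moreover have "?B \<longleftrightarrow> \<alpha> \<in> extensional (SObj C) \<and>
     (\<forall>x\<in>SObj C. \<alpha> x \<in> SHom D Tight [sobj F x] (sobj G x)) \<and>
     (\<forall>p q as b. \<forall>f\<in>BHom (biskew_of_left_skew C) p q as b.
        SComp D p [] (map (sobj F) as) [] (sobj F b) (sobj G b)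
          (SLoosen_to D p [sobj F b] (sobj G b) (\<alpha> b)) (shom F p as b f)
        = SComps D p [] (map (\<lambda>a. (sobj F a, sobj G a, \<alpha> a)) as) (sobj G b) (shom G p as b f))"
  proof -
    have bhom: "f \<in> BHom (biskew_of_left_skew C) p q as b \<Longrightarrow>
        bhom (biskew_map_of_left_skew F) p q as b f = shom F p as b f"
      for f p q as b and F :: "('a, 'b, 'c, 'd) skew_map"
      by (auto simp: biskew_map_of_left_skew_def split: if_splits)
    have unary: "BHom (biskew_of_left_skew D) p q [a] b = SHom D p [a] b" for p q a b by simp
    show ?thesis
      unfolding is_biskew_cell_def
      by (simp add: bhom unary bobj_biskew_map_of_left_skew cong: ball_cong
          del: biskew_of_left_skew_simps(2))
  qed
  ultimately show ?thesis by (simp add: is_left_skew_cell_def)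
qed

text \<open>The right-loose part determines everything: compatibility with right loosening, which is
  the identity function here, forces the right-tight values to agree with the right-loose
  ones.\<close>

lemma bij_betw_biskew_map_of_left_skew:
  "bij_betw biskew_map_of_left_skew (Ob (left_skew_hom_category C D))
     (Ob (biskew_hom_category (biskew_of_left_skew C) (biskew_of_left_skew D)))"
proof (rule bij_betwI')
  fix F G :: "('a, 'b, 'c, 'd) skew_map"
  show "biskew_map_of_left_skew F = biskew_map_of_left_skew G \<longleftrightarrow> F = G"
  proof
    assume eq: "biskew_map_of_left_skew F = biskew_map_of_left_skew G"
    have "shom F p as x = shom G p as x" for p as x
    proof -
      have "bhom (biskew_map_of_left_skew F) p Loose as x
          = bhom (biskew_map_of_left_skew G) p Loose as x"
        by (simp only: eq)
      then show ?thesis by (simp add: biskew_map_of_left_skew_def)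
    qed
    moreover have "sobj F = sobj G" using eq by (simp add: biskew_map_of_left_skew_def)
    ultimately show "F = G" by (cases F; cases G) (auto simp: fun_eq_iff)
  qed simp
next
  fix F
  assume "F \<in> Ob (left_skew_hom_category C D)"
  then show "biskew_map_of_left_skew F
      \<in> Ob (biskew_hom_category (biskew_of_left_skew C) (biskew_of_left_skew D))"
    by (simp add: left_skew_hom_category_def biskew_hom_category_def is_biskew_map_of_left_skew)
next
  fix G
  assume "G \<in> Ob (biskew_hom_category (biskew_of_left_skew C) (biskew_of_left_skew D))"
  then have G: "is_biskew_map (biskew_of_left_skew C) (biskew_of_left_skew D) G"
    by (simp add: biskew_hom_category_def)
  define F where "F = \<lparr>sobj = bobj G, shom = (\<lambda>p. bhom G p Loose)\<rparr>"
  have ext: "bhom G p q as x \<in> extensional (BHom (biskew_of_left_skew C) p q as x)" for p q as x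
    using G by (auto simp: is_biskew_map_def PiE_def)
  have "bhom G p Tight as x f = bhom G p Loose as x f" if "as \<noteq> []" for p as x f
  proof (cases "f \<in> SHom C p as x")
    case True
    have "\<forall>f\<in>BHom (biskew_of_left_skew C) p Tight as x.
        bhom G p Loose as x (BLoosenR (biskew_of_left_skew C) p as x f)
        = BLoosenR (biskew_of_left_skew D) p (map (bobj G) as) (bobj G x) (bhom G p Tight as x f)"
      using G unfolding is_biskew_map_def by blast
    then show ?thesis using True that by simp
  next
    \<comment> \<open>Outside the hom-set both values are \<open>undefined\<close> by
      extensionality.\<close>
    case False
    then show ?thesis using ext[of p Tight as x] ext[of p Loose as x] that
      by (simp add: extensional_def)
  qed
  moreover have "bhom G p Tight [] x f = undefined" for p x f
    using ext[of p Tight "[]" x] by (simp add: extensional_def)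
  ultimately have "bhom G p q as x = bhom (biskew_map_of_left_skew F) p q as x" for p q as x
    by (cases q) (auto simp: biskew_map_of_left_skew_def F_def fun_eq_iff)
  then have "G = biskew_map_of_left_skew F"
    by (cases G) (simp add: biskew_map_of_left_skew_def F_def fun_eq_iff)
  then show "\<exists>F\<in>Ob (left_skew_hom_category C D). G = biskew_map_of_left_skew F"
    using G by (auto simp: left_skew_hom_category_def is_biskew_map_of_left_skew)
qed

lemma biskew_biased_counterpart_of_left_skew:
  "biskew_biased_counterpart (biskew_map_of_left_skew F) = skew_biased_counterpart F"
  by (simp add: biskew_biased_counterpart_def skew_biased_counterpart_def
      biskew_map_of_left_skew_def)

lemma left_skew_coherence:
  assumes "left_skew_multicategory C"
  shows "component_isomorphism (left_skew_UnbiasMon C) (left_skew_Mon C) skew_biased_counterpart"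
proof (rule component_isomorphism_transfer)
  interpret biskew_multicategory "biskew_of_left_skew C"
    by (rule biskew_multicategory_of_left_skew[OF assms])
  show "component_isomorphism (biskew_UnbiasMon (biskew_of_left_skew C)) (left_skew_Mon C)
      biskew_biased_counterpart"
    using biskew_coherence by (simp add: biskew_Mon_of_left_skew)
  show "bij_betw biskew_map_of_left_skew (Ob (left_skew_UnbiasMon C))
      (Ob (biskew_UnbiasMon (biskew_of_left_skew C)))"
    unfolding left_skew_UnbiasMon_def biskew_UnbiasMon_def terminal_biskew_of_left_skew
    by (rule bij_betw_biskew_map_of_left_skew)
qed (simp_all add: left_skew_UnbiasMon_def biskew_UnbiasMon_def terminal_biskew_of_left_skew
    left_skew_hom_category_def biskew_hom_category_def is_biskew_cell_of_left_skew
    biskew_biased_counterpart_of_left_skew set_eq_iff)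

section \<open>Multicategories as left-skew multicategories\<close>

definition left_skew_of_multicat :: "('o, 'm) multicat \<Rightarrow> ('o, 'm) skew_multicat" where
  "left_skew_of_multicat C = \<lparr>
     SObj = MObj C,
     SHom = (\<lambda>p as x. if p = Tight \<and> as = [] then {} else MHom C as x),
     SLoosen = (\<lambda>as x f. f),
     SId = MId C,
     SComp = (\<lambda>p. MComp C) \<rparr>"

lemma left_skew_of_multicat_simps [simp]:
  "SObj (left_skew_of_multicat C) = MObj C"
  "SHom (left_skew_of_multicat C) p as x = (if p = Tight \<and> as = [] then {} else MHom C as x)"
  "SLoosen (left_skew_of_multicat C) as x f = f"
  "SId (left_skew_of_multicat C) = MId C"
  "SComp (left_skew_of_multicat C) p = MComp C"
  by (simp_all add: left_skew_of_multicat_def)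

lemma SLoosen_to_left_skew_of_multicat [simp]:
  "SLoosen_to (left_skew_of_multicat C) p as x f = f"
  by (cases p) (simp_all add: SLoosen_to_def)

lemma SComps_left_skew_of_multicat [simp]:
  "SComps (left_skew_of_multicat C) p pre ts y g = MComps C pre ts y g"
  by (induction ts arbitrary: pre g) (simp_all split: prod.split)

lemma left_skew_multicategory_of_multicat:
  assumes "multicategory C"
  shows "left_skew_multicategory (left_skew_of_multicat C)"
proof -
  interpret multicategory C by fact
  show ?thesis
    by unfold_locales
      (auto simp: hom_obj id_hom comp_hom assoc interchange comp_id id_comp
        dest: hom_obj split: if_splits)
qed

lemma left_skew_Mon_of_multicat: "left_skew_Mon (left_skew_of_multicat C) = Mon C"
  by (simp add: left_skew_Mon_def Mon_def is_left_skew_monoid_def is_monoid_def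
      is_left_skew_monoid_hom_def is_monoid_hom_def)

lemma terminal_left_skew_of_multicat: "terminal_left_skew = left_skew_of_multicat terminal_multicat"
  by (auto simp: terminal_left_skew_def left_skew_of_multicat_def terminal_multicat_def fun_eq_iff)

definition left_skew_map_of_multicat ::
  "('o, 'm, 'p, 'n) multicat_map \<Rightarrow> ('o, 'm, 'p, 'n) skew_map" where
  "left_skew_map_of_multicat F = \<lparr>
     sobj = mobj F,
     shom = (\<lambda>p as x. if p = Tight \<and> as = [] then (\<lambda>_. undefined) else mhom F as x) \<rparr>"

lemma sobj_left_skew_map_of_multicat [simp]: "sobj (left_skew_map_of_multicat F) = mobj F"
  by (simp add: left_skew_map_of_multicat_def)

text \<open>The loose part carries the whole multicategory map, and the tight part repeats it on
  nonempty sources.\<close>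

lemma is_left_skew_map_of_multicat:
  "is_left_skew_map (left_skew_of_multicat C) (left_skew_of_multicat D) (left_skew_map_of_multicat F)
    \<longleftrightarrow> is_multicat_map C D F" (is "?L \<longleftrightarrow> ?M")
proof
  assume L: ?L
  let ?F = "left_skew_map_of_multicat F"
  have hom: "mhom F as x \<in> MHom C as x \<rightarrow>\<^sub>E MHom D (map (mobj F) as) (mobj F x)" for as x
  proof -
    have "shom ?F Loose as x \<in> SHom (left_skew_of_multicat C) Loose as x
      \<rightarrow>\<^sub>E SHom (left_skew_of_multicat D) Loose (map (sobj ?F) as) (sobj ?F x)"
      using L by (simp only: is_left_skew_map_def)
    then show ?thesis by (simp add: left_skew_map_of_multicat_def)
  qed
  have comp: "mhom F (as @ bs @ cs) y (MComp C as bs cs x y g f)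
        = MComp D (map (mobj F) as) (map (mobj F) bs) (map (mobj F) cs) (mobj F x) (mobj F y)
            (mhom F (as @ x # cs) y g) (mhom F bs x f)"
    if "g \<in> MHom C (as @ x # cs) y" "f \<in> MHom C bs x" for as bs cs x y g f
  proof -
    have "\<forall>g\<in>SHom (left_skew_of_multicat C) Loose (as @ x # cs) y.
        \<forall>f\<in>SHom (left_skew_of_multicat C) (at_input Loose as) bs x.
        shom ?F Loose (as @ bs @ cs) y (SComp (left_skew_of_multicat C) Loose as bs cs x y g f)
        = SComp (left_skew_of_multicat D) Loose (map (sobj ?F) as) (map (sobj ?F) bs)
            (map (sobj ?F) cs) (sobj ?F x) (sobj ?F y)
            (shom ?F Loose (as @ x # cs) y g) (shom ?F (at_input Loose as) bs x f)"
      using L unfolding is_left_skew_map_def by blast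
    then show ?thesis using that by (simp add: left_skew_map_of_multicat_def)
  qed
  have "mobj F \<in> MObj C \<rightarrow>\<^sub>E MObj D"
    "\<forall>x\<in>MObj C. mhom F [x] x (MId C x) = MId D (mobj F x)"
    using L by (simp_all add: is_left_skew_map_def left_skew_map_of_multicat_def)
  then show ?M using hom comp unfolding is_multicat_map_def by blast
next
  assume M: ?M
  have [simp]: "shom (left_skew_map_of_multicat F) p as x =
       (if p = Tight \<and> as = [] then (\<lambda>_. undefined) else mhom F as x)" for p as x
    by (simp add: left_skew_map_of_multicat_def)
  show ?L
    using M by (auto simp: is_left_skew_map_def is_multicat_map_def split: if_splits)
qed

text \<open>Tight naturality is an instance of loose naturality, which leaves one condition for each
  morphism of \<open>C\<close>.\<close>

lemma is_left_skew_cell_of_multicat: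
  "is_left_skew_cell (left_skew_of_multicat C) (left_skew_of_multicat D)
      (left_skew_map_of_multicat F) (left_skew_map_of_multicat G) \<alpha>
    \<longleftrightarrow> is_multicat_cell C D F G \<alpha>" (is "?L \<longleftrightarrow> ?M")
proof -
  have "(\<forall>p as b. \<forall>f\<in>SHom (left_skew_of_multicat C) p as b. P as b f) \<longleftrightarrow>
      (\<forall>as b. \<forall>f\<in>MHom C as b. P as b f)" (is "?l \<longleftrightarrow> ?r") for P
  proof
    assume ?l
    then have "\<forall>f\<in>SHom (left_skew_of_multicat C) Loose as b. P as b f" for as b by blast
    then show ?r by simp
  qed simp
  moreover have "?L \<longleftrightarrow> \<alpha> \<in> extensional (MObj C) \<and>
     (\<forall>x\<in>MObj C. \<alpha> x \<in> MHom D [mobj F x] (mobj G x)) \<and>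
     (\<forall>p as b. \<forall>f\<in>SHom (left_skew_of_multicat C) p as b.
        MComp D [] (map (mobj F) as) [] (mobj F b) (mobj G b) (\<alpha> b) (mhom F as b f)
        = MComps D [] (map (\<lambda>a. (mobj F a, mobj G a, \<alpha> a)) as) (mobj G b) (mhom G as b f))"
  proof -
    have shom: "f \<in> SHom (left_skew_of_multicat C) p as b \<Longrightarrow>
        shom (left_skew_map_of_multicat F) p as b f = mhom F as b f"
      for f p as b and F :: "('a, 'b, 'c, 'd) multicat_map"
      by (auto simp: left_skew_map_of_multicat_def split: if_splits)
    have unary: "SHom (left_skew_of_multicat D) p [a] b = MHom D [a] b" for p a b by simp
    show ?thesis
      unfolding is_left_skew_cell_def
      by (simp add: shom unary cong: ball_cong del: left_skew_of_multicat_simps(2))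
  qed
  ultimately show ?thesis by (simp add: is_multicat_cell_def)
qed

text \<open>Loosening is the identity function, so a left-skew map between such objects has no
  freedom in its tight part.\<close>

lemma bij_betw_left_skew_map_of_multicat:
  "bij_betw left_skew_map_of_multicat (Ob (multicat_hom_category C D))
     (Ob (left_skew_hom_category (left_skew_of_multicat C) (left_skew_of_multicat D)))"
proof (rule bij_betwI')
  fix F G :: "('a, 'b, 'c, 'd) multicat_map"
  show "left_skew_map_of_multicat F = left_skew_map_of_multicat G \<longleftrightarrow> F = G"
  proof
    assume eq: "left_skew_map_of_multicat F = left_skew_map_of_multicat G"
    have "mhom F as x = mhom G as x" for as x
    proof -
      have "shom (left_skew_map_of_multicat F) Loose as x
          = shom (left_skew_map_of_multicat G) Loose as x"
        by (simp only: eq)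
      then show ?thesis by (simp add: left_skew_map_of_multicat_def)
    qed
    moreover have "mobj F = mobj G" using eq by (simp add: left_skew_map_of_multicat_def)
    ultimately show "F = G" by (cases F; cases G) (auto simp: fun_eq_iff)
  qed simp
next
  fix F
  assume "F \<in> Ob (multicat_hom_category C D)"
  then show "left_skew_map_of_multicat F
      \<in> Ob (left_skew_hom_category (left_skew_of_multicat C) (left_skew_of_multicat D))"
    by (simp add: multicat_hom_category_def left_skew_hom_category_def is_left_skew_map_of_multicat)
next
  fix G
  assume "G \<in> Ob (left_skew_hom_category (left_skew_of_multicat C) (left_skew_of_multicat D))"
  then have G: "is_left_skew_map (left_skew_of_multicat C) (left_skew_of_multicat D) G"
    by (simp add: left_skew_hom_category_def)
  define F where "F = \<lparr>mobj = sobj G, mhom = shom G Loose\<rparr>"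
  have ext: "shom G p as x \<in> extensional (SHom (left_skew_of_multicat C) p as x)" for p as x
    using G by (auto simp: is_left_skew_map_def PiE_def)
  have "shom G Tight as x f = shom G Loose as x f" if "as \<noteq> []" for as x f
  proof (cases "f \<in> MHom C as x")
    case True
    have "\<forall>f\<in>SHom (left_skew_of_multicat C) Tight as x.
        shom G Loose as x (SLoosen (left_skew_of_multicat C) as x f)
        = SLoosen (left_skew_of_multicat D) (map (sobj G) as) (sobj G x) (shom G Tight as x f)"
      using G unfolding is_left_skew_map_def by blast
    then show ?thesis using True that by simp
  next
    case False
    then show ?thesis using ext[of Tight as x] ext[of Loose as x] that
      by (simp add: extensional_def)
  qed
  moreover have "shom G Tight [] x f = undefined" for x f
    using ext[of Tight "[]" x] by (simp add: extensional_def)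
  ultimately have "shom G p as x = shom (left_skew_map_of_multicat F) p as x" for p as x
    by (cases p) (auto simp: left_skew_map_of_multicat_def F_def fun_eq_iff)
  then have "G = left_skew_map_of_multicat F"
    by (cases G) (simp add: left_skew_map_of_multicat_def F_def fun_eq_iff)
  then show "\<exists>F\<in>Ob (multicat_hom_category C D). G = left_skew_map_of_multicat F"
    using G by (auto simp: multicat_hom_category_def is_left_skew_map_of_multicat)
qed

lemma skew_biased_counterpart_of_multicat:
  "skew_biased_counterpart (left_skew_map_of_multicat F) = biased_counterpart F"
  by (simp add: skew_biased_counterpart_def biased_counterpart_def left_skew_map_of_multicat_def)

lemma multicategory_coherence:
  assumes "multicategory C"
  shows "component_isomorphism (UnbiasMon C) (Mon C) biased_counterpart"
proof (rule component_isomorphism_transfer)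
  show "component_isomorphism (left_skew_UnbiasMon (left_skew_of_multicat C)) (Mon C)
      skew_biased_counterpart"
    using left_skew_coherence[OF left_skew_multicategory_of_multicat[OF assms]]
    by (simp add: left_skew_Mon_of_multicat)
  show "bij_betw left_skew_map_of_multicat (Ob (UnbiasMon C))
      (Ob (left_skew_UnbiasMon (left_skew_of_multicat C)))"
    unfolding left_skew_UnbiasMon_def UnbiasMon_def terminal_left_skew_of_multicat
    by (rule bij_betw_left_skew_map_of_multicat)
qed (simp_all add: left_skew_UnbiasMon_def UnbiasMon_def terminal_left_skew_of_multicat
    left_skew_hom_category_def multicat_hom_category_def is_left_skew_cell_of_multicat
    skew_biased_counterpart_of_multicat set_eq_iff)

section \<open>Coherence in all four settings\<close>

theorem theorem5:
  fixes C :: "('o1, 'm1) multicat"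
    and L :: "('o2, 'm2) skew_multicat"
    and R :: "('o3, 'm3) skew_multicat"
    and B :: "('o4, 'm4) biskew_multicat"
  shows "(multicategory C \<longrightarrow>
           isomorphism_of_categories (UnbiasMon C) (Mon C)
             biased_counterpart the_component) \<and>
         (left_skew_multicategory L \<longrightarrow>
           isomorphism_of_categories (left_skew_UnbiasMon L) (left_skew_Mon L)
             skew_biased_counterpart the_component) \<and>
         (right_skew_multicategory R \<longrightarrow>
           isomorphism_of_categories (right_skew_UnbiasMon R) (right_skew_Mon R)
             skew_biased_counterpart the_component) \<and>
         (biskew_multicategory B \<longrightarrow>
           isomorphism_of_categories (biskew_UnbiasMon B) (biskew_Mon B)
             biskew_biased_counterpart the_component)"
  \<comment> \<open>The right-skew notions unfold to the left-skew ones for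
    \<open>skew_rev R\<close>, so left-skew coherence serves two of the four cases.\<close>
  unfolding right_skew_multicategory_def right_skew_UnbiasMon_def right_skew_Mon_def
  by (intro conjI impI component_isomorphism_imp_isomorphism multicategory_coherence
      left_skew_coherence biskew_multicategory.biskew_coherence)

end
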